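(* Let $X$ be a metric space, let $\pi_0$ be a local semiflow on $X$ and let $\pi_n$, $n\in\mathbb{N}=\{1,2,\dots\}$, be local semiflows on $\mathbb{R}\times X$. Suppose $\tilde N$ is a closed set in $X$ which is strongly $\pi_0$-admissible. Moreover, assume that $\pi_n$ converges semi-singularly to $\pi_0$ as $n\to\infty$ and that $\mathbb{R}\times\tilde N$ is strongly $\{\pi_{n_m}\}$-semi-singular-admissible for all subsequences $\{\pi_{n_m}\}_{m\in\mathbb{N}}$. Let $\pi$ be the local semiflow on $\mathbb{R}\times X$ given by $(s,x)\pi t=(s+t,x\pi_0t)$. Set $K_n=A_{\pi_n}(\mathbb{R}\times\tilde N)$ for $n\ge 1$, $K_0=A_\pi(\mathbb{R}\times\tilde N)$, and assume $K=A_{\pi_0}(\tilde N)\subset\operatorname{int}\tilde N$. Then there exist an $n_0\in\mathbb{N}$ and two closed sets $N,N'\subset X$ such that for each $n\in\{n\ge n_0\}\cup\{0\}$ there are two index pairs $\langle N_n,L_n\rangle$ and $\langle N_n',L_n'\rangle$ with the following properties: 1. $K_n\subset\mathbb{R}\times N'\subset\operatorname{int}(\mathbb{R}\times N)\subset\operatorname{int}(\mathbb{R}\times\tilde N)$, $N_0'=\mathbb{R}\times N'$ and $N_0=\mathbb{R}\times N$; 2. $\langle N_n',L_n'\rangle$ (resp. $\langle N_n,L_n\rangle$) is an index pair in $N_0'$ (resp. in $N_0$) with respect to $\pi_n$ (resp. with respect to $\pi$ if $n=0$); 3. $N_n'\subset N_0'\subset N_n\subset N_0$ and $L_n'\subset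 L_0'\subset L_n\subset L_0$.
   Context: A local semiflow on a topological space $Z$ is a continuous map $\pi:D\to Z$, $D$ open in $\mathbb{R}^{+}\times Z$ (with $\mathbb{R}^+=[0,\infty)$), $\{0\}\times Z\subset D$, written $x\pi t=\pi(t,x)$, such that with $\omega_x=\omega_x^\pi=\sup\{t>0\mid(t,x)\in D\}\in(0,\infty]$ one has $D\cap(\mathbb{R}\times\{x\})=[0,\omega_x)\times\{x\}$, $x\pi0=x$, and if $(t,x)\in D$ and $(s,x\pi t)\in D$ then $x\pi(s+t)$ is defined and equals $(x\pi t)\pi s$. $x\pi[0,t]=\{x\pi s\mid s\in[0,t]\}$ (defined only if $t<\omega_x$). $P_2(s,x)=x$. A full left solution through $x$ is a map $\sigma$ on some $J\subset\mathbb{R}$ with $\mathbb{R}^-=(-\infty,0]\subset J$, $\sigma(0)=x$, and $\sigma(t+s)=\sigma(t)\pi s$ whenever $t,t+s\in J$, $0<s<\omega_{\sigma(t)}$. For $Y\subset Z$: $A_\pi^+(Y)=\{x\in Y\mid x\pi t\in Y\ \forall t\in[0,\omega_x)\}$, $A_\pi^-(Y)=\{x\in Y\mid\exists$ a full left solution $\sigma$ through $x$ with $\sigma(\mathbb{R}^-)\subset Y\}$, $A_\pi(Y)=A_\pi^+(Y)\cap A_\pi^-(Y)$ (the maximal invariant set in $Y$). A closed set $Y$ is an isolating neighborhood (for $A_\pi(Y)$) if $A_\pi(Y)\subset\operatorname{int}Y$. Semi-singular convergence of $\pi_n$ to $\pi_0$: for all sequences $(s_n,x_n)\in\mathbb{R}\times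 X$, $t_n\ge0$ with $x_n\to x_0$, $t_n\to t_0$ ($s_n$ arbitrary) and $t_0<\omega^{\pi_0}_{x_0}$, $(s_n,x_n)\pi_nt_n$ is defined for all large $n$ and $P_2((s_n,x_n)\pi_nt_n)\to x_0\pi_0t_0$. Strong $\pi_0$-admissibility of a closed $Y\subset X$: (i) whenever $x_n\in X$, $0\le t_n<\omega_{x_n}$, $t_n\to\infty$ and $x_n\pi_0[0,t_n]\subset Y$, the sequence $\{x_n\pi_0t_n\}$ has a convergent subsequence; (ii) $x\pi_0[0,\omega_x)\subset Y$ implies $\omega_x=\infty$. Strong $\{\pi_n\}$-semi-singular-admissibility of a closed $Y\subset\mathbb{R}\times X$: (i) whenever $s_n\in\mathbb{R}$, $x_n\in X$, $0\le t_n<\omega^{\pi_n}_{(s_n,x_n)}$, $t_n\to\infty$ and $(s_n,x_n)\pi_n[0,t_n]\subset Y$, the sequence $\{P_2((s_n,x_n)\pi_nt_n)\}$ has a convergent subsequence; (ii) for each $n$, $(s,x)\pi_n[0,\omega^{\pi_n}_{(s,x)})\subset Y$ implies $\omega^{\pi_n}_{(s,x)}=\infty$. Index pair: let $M$ be a closed isolating neighborhood for $A_\pi(M)$ with respect to $\pi$. A pair $\langle N,L\rangle$ is an index pair in $M$ with respect to $\pi$ if $L\subset N\subset M$ and (1) $A_\pi(M)\subset\operatorname{int}(N\setminus L)$ and $A_\pi(M)$ is the maximal invariant set in $\operatorname{cl}(N\setminus L)$; (2) if $x\in L$ and $x\pi[0,\epsilon]\subset N$ then $x\pi[0,\epsilon]\subset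 L$; (3) if $x\in N$ and $x\pi[0,\omega_x)\not\subset N$ then there is $0\le t<\omega_x$ with $x\pi t\in L$. *)

theory Defs
  imports "HOL-Analysis.Analysis"
begin

text \<open>A local semiflow is represented by a partial map on (time, point) pairs; its domain
  \<open>dom \<pi>\<close> is the set \<open>D\<close> on which the semiflow is defined.\<close>

type_synonym 'z pflow = "real \<times> 'z \<rightharpoonup> 'z"

definition run :: "'z pflow \<Rightarrow> 'z \<Rightarrow> real \<Rightarrow> 'z" where
  "run \<pi> x t = the (\<pi> (t, x))"

definition omega :: "'z pflow \<Rightarrow> 'z \<Rightarrow> ereal" where
  "omega \<pi> x = Sup (ereal ` {t. 0 < t \<and> (t, x) \<in> dom \<pi>})"

definition life :: "'z pflow \<Rightarrow> 'z \<Rightarrow> real set" where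
  "life \<pi> x = {t. 0 \<le> t \<and> ereal t < omega \<pi> x}"

definition local_semiflow :: "'z::topological_space pflow \<Rightarrow> bool" where
  "local_semiflow \<pi> \<longleftrightarrow>
     openin (top_of_set ({0..} \<times> UNIV)) (dom \<pi>) \<and>
     {0} \<times> UNIV \<subseteq> dom \<pi> \<and>
     continuous_on (dom \<pi>) (\<lambda>(t, x). run \<pi> x t) \<and>
     (\<forall>x. 0 < omega \<pi> x \<and> dom \<pi> \<inter> (UNIV \<times> {x}) = life \<pi> x \<times> {x}) \<and>
     (\<forall>x. run \<pi> x 0 = x) \<and>
     (\<forall>x s t. (t, x) \<in> dom \<pi> \<and> (s, run \<pi> x t) \<in> dom \<pi> \<longrightarrow>
        (s + t, x) \<in> dom \<pi> \<and> run \<pi> x (s + t) = run \<pi> (run \<pi> x t) s)"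

definition full_left_solution ::
    "'z pflow \<Rightarrow> real set \<Rightarrow> (real \<Rightarrow> 'z) \<Rightarrow> 'z \<Rightarrow> bool" where
  "full_left_solution \<pi> J \<sigma> x \<longleftrightarrow>
     {..0} \<subseteq> J \<and> \<sigma> 0 = x \<and>
     (\<forall>t s. t \<in> J \<and> t + s \<in> J \<and> 0 < s \<and> ereal s < omega \<pi> (\<sigma> t) \<longrightarrow>
        \<sigma> (t + s) = run \<pi> (\<sigma> t) s)"

definition inv_plus :: "'z pflow \<Rightarrow> 'z set \<Rightarrow> 'z set" where
  "inv_plus \<pi> Y = {x \<in> Y. \<forall>t \<in> life \<pi> x. run \<pi> x t \<in> Y}"

definition inv_minus :: "'z pflow \<Rightarrow> 'z set \<Rightarrow> 'z set" where
  "inv_minus \<pi> Y = {x \<in> Y. \<exists>J \<sigma>. full_left_solution \<pi> J \<sigma> x \<and> \<sigma> ` {..0} \<subseteq> Y}"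

definition max_inv :: "'z pflow \<Rightarrow> 'z set \<Rightarrow> 'z set" where
  "max_inv \<pi> Y = inv_plus \<pi> Y \<inter> inv_minus \<pi> Y"

definition isolating_neighborhood :: "'z::topological_space pflow \<Rightarrow> 'z set \<Rightarrow> bool" where
  "isolating_neighborhood \<pi> Y \<longleftrightarrow> closed Y \<and> max_inv \<pi> Y \<subseteq> interior Y"

text \<open>A sequence of semiflows is indexed by \<open>{1, 2, \<dots>}\<close>; its value at \<open>0\<close> is irrelevant.\<close>

definition semi_singular_convergence ::
    "(nat \<Rightarrow> (real \<times> 'x::topological_space) pflow) \<Rightarrow> 'x pflow \<Rightarrow> bool" where
  "semi_singular_convergence \<pi>s \<pi>0 \<longleftrightarrow>
     (\<forall>(s :: nat \<Rightarrow> real) x t x0 t0.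
        (\<forall>n\<ge>1. 0 \<le> t n) \<and> x \<longlonglongrightarrow> x0 \<and> t \<longlonglongrightarrow> t0 \<and> ereal t0 < omega \<pi>0 x0 \<longrightarrow>
        (\<forall>\<^sub>F n in sequentially. (t n, (s n, x n)) \<in> dom (\<pi>s n)) \<and>
        (\<lambda>n. snd (run (\<pi>s n) (s n, x n) (t n))) \<longlonglongrightarrow> run \<pi>0 x0 t0)"

definition strongly_admissible :: "'x::topological_space pflow \<Rightarrow> 'x set \<Rightarrow> bool" where
  "strongly_admissible \<pi> Y \<longleftrightarrow>
     closed Y \<and>
     (\<forall>(x :: nat \<Rightarrow> 'x) t.
        (\<forall>n\<ge>1. t n \<in> life \<pi> (x n) \<and> run \<pi> (x n) ` {0..t n} \<subseteq> Y) \<and>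
        filterlim t at_top sequentially \<longrightarrow>
        (\<exists>r l. strict_mono r \<and> (\<lambda>n. run \<pi> (x (r n)) (t (r n))) \<longlonglongrightarrow> l)) \<and>
     (\<forall>x. run \<pi> x ` life \<pi> x \<subseteq> Y \<longrightarrow> omega \<pi> x = \<infinity>)"

definition strongly_semi_singular_admissible ::
    "(nat \<Rightarrow> (real \<times> 'x::topological_space) pflow) \<Rightarrow> (real \<times> 'x) set \<Rightarrow> bool" where
  "strongly_semi_singular_admissible \<pi>s Y \<longleftrightarrow>
     closed Y \<and>
     (\<forall>(s :: nat \<Rightarrow> real) (x :: nat \<Rightarrow> 'x) t.
        (\<forall>n\<ge>1. t n \<in> life (\<pi>s n) (s n, x n) \<and> run (\<pi>s n) (s n, x n) ` {0..t n} \<subseteq> Y) \<and>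
        filterlim t at_top sequentially \<longrightarrow>
        (\<exists>r l. strict_mono r \<and>
           (\<lambda>n. snd (run (\<pi>s (r n)) (s (r n), x (r n)) (t (r n)))) \<longlonglongrightarrow> l)) \<and>
     (\<forall>n\<ge>1. \<forall>s x. run (\<pi>s n) (s, x) ` life (\<pi>s n) (s, x) \<subseteq> Y \<longrightarrow>
        omega (\<pi>s n) (s, x) = \<infinity>)"

definition index_pair ::
    "'z::topological_space pflow \<Rightarrow> 'z set \<Rightarrow> 'z set \<Rightarrow> 'z set \<Rightarrow> bool" where
  "index_pair \<pi> M N L \<longleftrightarrow>
     isolating_neighborhood \<pi> M \<and> L \<subseteq> N \<and> N \<subseteq> M \<and>
     max_inv \<pi> M \<subseteq> interior (N - L) \<and>
     max_inv \<pi> M = max_inv \<pi> (closure (N - L)) \<and>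
     (\<forall>x \<in> L. \<forall>\<epsilon> \<in> life \<pi> x. run \<pi> x ` {0..\<epsilon>} \<subseteq> N \<longrightarrow> run \<pi> x ` {0..\<epsilon>} \<subseteq> L) \<and>
     (\<forall>x \<in> N. \<not> run \<pi> x ` life \<pi> x \<subseteq> N \<longrightarrow> (\<exists>t \<in> life \<pi> x. run \<pi> x t \<in> L))"

text \<open>The semiflow \<open>(s, x) \<pi> t = (s + t, x \<pi>0 t)\<close>, defined exactly where \<open>x \<pi>0 t\<close> is.\<close>

definition time_extension :: "'x pflow \<Rightarrow> (real \<times> 'x) pflow" where
  "time_extension \<pi>0 = (\<lambda>(t, (s, x)). map_option (\<lambda>y. (s + t, y)) (\<pi>0 (t, x)))"

definition extended_family ::
    "'x pflow \<Rightarrow> (nat \<Rightarrow> (real \<times> 'x) pflow) \<Rightarrow> nat \<Rightarrow> (real \<times> 'x) pflow" where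
  "extended_family \<pi>0 \<pi>s n = (if n = 0 then time_extension \<pi>0 else \<pi>s n)"

end

theory Submission
  imports Defs
begin

text \<open>An index pair can be made from exit times alone. Let \<open>B\<close> be a closed neighbourhood of the
  invariant set \<open>K\<close> and let \<open>D\<close> be a positively invariant set relative to \<open>B\<close>. For \<open>T < T'\<close>, the points of \<open>D\<close> whose
  orbit stays in \<open>B\<close> up to time \<open>T\<close>, together with those among them whose orbit does not stay up to
  time \<open>T'\<close>, form an index pair (\<open>index_pair_of_exit_times\<close>), because the remaining time in \<open>B\<close> runs
  down continuously along orbits. For two flows the pairs are nested if a stay in \<open>B\<close> for the larger
  time under one flow implies a stay for the smaller time under the other.

  On a space that need not be locally compact such a comparison is hopeless on all of \<open>B\<close>, for
  semi-singular convergence controls only convergent sequences of points. It does hold near the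
  unstable set \<open>A\<^sup>-\<close> of the limit flow in \<open>Nt\<close>: this set is compact by admissibility,
  a point of it that also stays in \<open>Nt\<close> for all future belongs to \<open>K\<close>, and orbits starting near \<open>K\<close>
  stay in \<open>B\<close> for any prescribed time under all flows of large index. Hence, near \<open>A\<^sup>-\<close>, for every \<open>T\<close>
  there is an \<open>S\<close> such that a stay for time \<open>S\<close> under one flow forces a stay for time \<open>T\<close> under all others
  (\<open>forces_stay_exists\<close>). Moreover orbits that start near \<open>A\<^sup>-\<close> remain near it while
  they are in \<open>Nt\<close> (\<open>unstable_absorbs\<close>), so for \<open>D\<close> one can take sets of points whose orbits are
  confined to a neighbourhood of \<open>A\<^sup>-\<close>; they contain smaller neighbourhoods of \<open>A\<^sup>-\<close> in \<open>B\<close>.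

  Four levels are needed, one for each of \<open>N\<^sub>0\<close>, \<open>N\<^sub>n\<close>, \<open>N'\<^sub>0\<close>, \<open>N'\<^sub>n\<close>. From outside to inside the
  neighbourhoods shrink, the times \<open>T\<close> grow, which nests the sets \<open>N\<close>, and the times \<open>T'\<close>
  decrease, which nests the sets \<open>L\<close>. All these choices are finite in number and can be made in the order
  times, neighbourhoods, indices (\<open>nested_index_pairs\<close>).\<close>

section \<open>Orbits, maximal invariant sets and exit times\<close>

text \<open>The algebraic content of a local semiflow, with the cocycle identity for lifetimes in both
  directions. It holds for the time extension of a local semiflow by mere computation, and it is all
  that the construction of index pairs uses about an individual flow.\<close>

definition semiflow_law :: "'z pflow \<Rightarrow> bool" where
  "semiflow_law \<psi> \<longleftrightarrow>
     (\<forall>z. 0 \<in> life \<psi> z \<and> run \<psi> z 0 = z) \<and>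
     (\<forall>z s t. s \<in> life \<psi> z \<longrightarrow> 0 \<le> t \<longrightarrow>
        (s + t \<in> life \<psi> z \<longleftrightarrow> t \<in> life \<psi> (run \<psi> z s)) \<and>
        (t \<in> life \<psi> (run \<psi> z s) \<longrightarrow> run \<psi> z (s + t) = run \<psi> (run \<psi> z s) t))"

definition stays :: "'z pflow \<Rightarrow> 'z \<Rightarrow> real \<Rightarrow> 'z set \<Rightarrow> bool" where
  "stays \<psi> z T Y \<longleftrightarrow> (\<forall>t\<in>{0..T}. t \<in> life \<psi> z \<and> run \<psi> z t \<in> Y)"

definition no_blowup_in :: "'z pflow \<Rightarrow> 'z set \<Rightarrow> bool" where
  "no_blowup_in \<psi> Y \<longleftrightarrow> (\<forall>z. run \<psi> z ` life \<psi> z \<subseteq> Y \<longrightarrow> life \<psi> z = {0..})"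

lemma lifeD: "t \<in> life \<psi> z \<Longrightarrow> 0 \<le> t"
  by (simp add: life_def)

lemma life_downward: "t \<in> life \<psi> z \<Longrightarrow> 0 \<le> s \<Longrightarrow> s \<le> t \<Longrightarrow> s \<in> life \<psi> z"
  unfolding life_def using le_less_trans ereal_less_eq(3) by blast

lemma life_eq_all_iff: "life \<psi> z = {0..} \<longleftrightarrow> omega \<psi> z = \<infinity>"
proof
  assume L: "life \<psi> z = {0..}"
  show "omega \<psi> z = \<infinity>"
  proof (rule ccontr)
    assume n: "omega \<psi> z \<noteq> \<infinity>"
    have "ereal 0 < omega \<psi> z"
      using L unfolding life_def by force
    then obtain r where r: "omega \<psi> z = ereal r" "0 < r"
      using n by (cases "omega \<psi> z") auto
    then have "r \<in> {0..}" "r \<notin> life \<psi> z"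
      by (auto simp: life_def)
    then show False using L by simp
  qed
qed (auto simp: life_def)

lemma dom_iff_life:
  assumes "local_semiflow \<psi>"
  shows "(t, z) \<in> dom \<psi> \<longleftrightarrow> t \<in> life \<psi> z"
proof -
  have "dom \<psi> \<inter> (UNIV \<times> {z}) = life \<psi> z \<times> {z}"
    using assms unfolding local_semiflow_def by blast
  then show ?thesis by blast
qed

text \<open>Only one implication is not part of the definition: an orbit that reaches time \<open>s + t\<close> does so
  after restarting at time \<open>s\<close>. If the restarted orbit died at \<open>w \<le> t\<close>, then the original orbit would
  converge to its point at time \<open>s + w\<close>; as the domain is open, points near that one survive for a
  uniform additional time, so the restarted orbit would outlive \<open>w\<close>.\<close>

lemma local_semiflow_law:
  assumes l: "local_semiflow \<psi>"
  shows "semiflow_law \<psi>"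
proof -
  note d = dom_iff_life[OF l]
  have op: "openin (top_of_set ({0..} \<times> UNIV)) (dom \<psi>)"
    and cont: "continuous_on (dom \<psi>) (\<lambda>(t, x). run \<psi> x t)"
    and zero: "\<And>z. 0 \<in> life \<psi> z" "\<And>z. run \<psi> z 0 = z"
    and add: "\<And>x s t. t \<in> life \<psi> x \<Longrightarrow> s \<in> life \<psi> (run \<psi> x t) \<Longrightarrow>
        s + t \<in> life \<psi> x \<and> run \<psi> x (s + t) = run \<psi> (run \<psi> x t) s"
  proof -
    show "openin (top_of_set ({0..} \<times> UNIV)) (dom \<psi>)"
      "continuous_on (dom \<psi>) (\<lambda>(t, x). run \<psi> x t)" "\<And>z. run \<psi> z 0 = z"
      using l unfolding local_semiflow_def by blast+
    show "0 \<in> life \<psi> z" for z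
      using l unfolding local_semiflow_def d[symmetric] by blast
    show "s + t \<in> life \<psi> x \<and> run \<psi> x (s + t) = run \<psi> (run \<psi> x t) s"
      if "t \<in> life \<psi> x" "s \<in> life \<psi> (run \<psi> x t)" for x s t
      using l that unfolding local_semiflow_def d[symmetric] by blast
  qed
  have sub: "t \<in> life \<psi> (run \<psi> z s)"
    if s: "s \<in> life \<psi> z" and t: "0 \<le> t" and st: "s + t \<in> life \<psi> z" for z s t
  proof (rule ccontr)
    assume nt: "t \<notin> life \<psi> (run \<psi> z s)"
    define y where "y = run \<psi> z s"
    have pos: "0 < omega \<psi> y" using l unfolding local_semiflow_def by blast
    have le: "omega \<psi> y \<le> ereal t" using nt t by (simp add: life_def y_def)
    then obtain w where w: "omega \<psi> y = ereal w" "0 < w" "w \<le> t"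
      using pos by (cases "omega \<psi> y") auto
    have life_y: "life \<psi> y = {0..<w}" using w by (auto simp: life_def)
    have sw: "s + w \<in> life \<psi> z"
      by (rule life_downward[OF st]) (use w lifeD[OF s] in auto)
    obtain T where T: "open T" "dom \<psi> = ({0..} \<times> UNIV) \<inter> T"
      using op unfolding openin_open by blast
    have "(0, run \<psi> z (s + w)) \<in> T" using zero T(2) d by blast
    then obtain A B where AB: "open A" "open B" "0 \<in> A" "run \<psi> z (s + w) \<in> B" "A \<times> B \<subseteq> T"
      using open_prod_elim[OF T(1), of "(0, run \<psi> z (s + w))"] by (metis mem_Sigma_iff)
    obtain e where e: "e > 0" "ball 0 e \<subseteq> A"
      using openE[OF AB(1,3)] by blast
    have ce: "continuous_on {0..s+w} (\<lambda>t. run \<psi> z t)"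
    proof -
      have "(\<lambda>t. (t, z)) ` {0..s+w} \<subseteq> dom \<psi>"
      proof (rule image_subsetI)
        fix t assume "t \<in> {0..s+w}"
        then show "(t, z) \<in> dom \<psi>" unfolding d using life_downward[OF sw] by simp
      qed
      then have "continuous_on {0..s+w} ((\<lambda>(t, x). run \<psi> x t) \<circ> (\<lambda>t. (t, z)))"
        by (intro continuous_on_compose continuous_intros continuous_on_subset[OF cont])
      then show ?thesis by (simp add: o_def)
    qed
    \<comment> \<open>Near the end of its alleged life the orbit is close to a point that lives for a uniform
      additional time, which extends it beyond that end.\<close>
    have "((\<lambda>t. run \<psi> z t) \<longlongrightarrow> run \<psi> z (s + w)) (at (s + w) within {0..s+w})"
      using ce lifeD[OF sw] by (auto simp: continuous_on_def)
    then have "\<forall>\<^sub>F t in at (s + w) within {0..s+w}. run \<psi> z t \<in> B"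
      using AB topological_tendstoD by blast
    then have "\<exists>b>0. \<forall>t\<in>{0..s+w}. t \<noteq> s + w \<and> dist t (s+w) < b \<longrightarrow> run \<psi> z t \<in> B"
      by (simp add: eventually_at)
    then obtain b where b: "b > 0"
      "\<And>t. t \<in> {0..s+w} \<Longrightarrow> t \<noteq> s + w \<Longrightarrow> dist t (s+w) < b \<Longrightarrow> run \<psi> z t \<in> B"
      by metis
    define r where "r = w - min (min (b/2) (e/4)) w"
    have r: "0 \<le> r" "r < w" "w - r < b" "w - r < e / 2"
      using b(1) e(1) w(2) by (auto simp: r_def min_def)
    have "run \<psi> z (s + r) \<in> B"
      by (rule b(2)) (use r lifeD[OF s] in \<open>auto simp: dist_real_def\<close>)
    moreover have "e / 2 \<in> A" using e by auto
    ultimately have "(e / 2, run \<psi> z (s + r)) \<in> dom \<psi>"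
      using T(2) AB(5) e(1) by auto
    then have h: "e / 2 \<in> life \<psi> (run \<psi> z (s + r))" by (simp add: d)
    have ry: "r \<in> life \<psi> y" using r life_y by auto
    have "run \<psi> z (s + r) = run \<psi> y r"
      using add[OF s, of r] ry by (simp add: y_def add.commute)
    then have "e / 2 + r \<in> life \<psi> y"
      using add[OF ry, of "e / 2"] h by simp
    then show False using life_y r by auto
  qed
  show ?thesis
    unfolding semiflow_law_def
  proof (intro conjI allI impI)
    fix z and s t :: real assume s: "s \<in> life \<psi> z" and t: "0 \<le> t"
    show "s + t \<in> life \<psi> z \<longleftrightarrow> t \<in> life \<psi> (run \<psi> z s)"
      using add[OF s, of t] sub[OF s t] by (auto simp: add.commute)
    show "run \<psi> z (s + t) = run \<psi> (run \<psi> z s) t" if "t \<in> life \<psi> (run \<psi> z s)"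
      using add[OF s that] by (simp add: add.commute)
  qed (use zero in auto)
qed

lemma stays_mono: "stays \<psi> z T Y \<Longrightarrow> S \<le> T \<Longrightarrow> Y \<subseteq> Z \<Longrightarrow> stays \<psi> z S Z"
  unfolding stays_def using atLeastAtMost_iff order_trans subsetD by meson

lemma stays_run: "stays \<psi> z T Y \<Longrightarrow> 0 \<le> t \<Longrightarrow> t \<le> T \<Longrightarrow> run \<psi> z t \<in> Y"
  by (simp add: stays_def)

lemma stays_life: "stays \<psi> z T Y \<Longrightarrow> 0 \<le> t \<Longrightarrow> t \<le> T \<Longrightarrow> t \<in> life \<psi> z"
  by (simp add: stays_def)

context
  fixes \<psi> :: "'z pflow"
  assumes law: "semiflow_law \<psi>"
begin

lemma zero_in_life: "0 \<in> life \<psi> z"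
  using law by (simp add: semiflow_law_def)

lemma run_zero: "run \<psi> z 0 = z"
  using law by (simp add: semiflow_law_def)

lemma life_add_iff: "s \<in> life \<psi> z \<Longrightarrow> 0 \<le> t \<Longrightarrow> s + t \<in> life \<psi> z \<longleftrightarrow> t \<in> life \<psi> (run \<psi> z s)"
  using law by (simp add: semiflow_law_def)

lemma run_add: "s \<in> life \<psi> z \<Longrightarrow> t \<in> life \<psi> (run \<psi> z s) \<Longrightarrow> run \<psi> z (s + t) = run \<psi> (run \<psi> z s) t"
  using law lifeD[of t \<psi> "run \<psi> z s"] by (simp add: semiflow_law_def)

lemma stays_zero: "stays \<psi> z 0 Y \<longleftrightarrow> z \<in> Y"
  by (simp add: stays_def zero_in_life run_zero)

lemma stays_in: "stays \<psi> z T Y \<Longrightarrow> 0 \<le> T \<Longrightarrow> z \<in> Y"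
  using stays_run[of \<psi> z T Y 0] by (simp add: run_zero)

lemma stays_suffix:
  assumes "stays \<psi> z (s + t) Y" "0 \<le> s"
  shows "stays \<psi> (run \<psi> z s) t Y"
  unfolding stays_def
proof
  fix r assume r: "r \<in> {0..t}"
  have s: "s \<in> life \<psi> z" by (rule stays_life[OF assms(1)]) (use r assms in auto)
  have "s + r \<in> life \<psi> z" "run \<psi> z (s + r) \<in> Y"
    using assms r by (auto simp: stays_def)
  then show "r \<in> life \<psi> (run \<psi> z s) \<and> run \<psi> (run \<psi> z s) r \<in> Y"
    using life_add_iff[OF s] run_add[OF s] r by auto
qed

lemma stays_append:
  assumes a: "stays \<psi> z s Y" and b: "stays \<psi> (run \<psi> z s) t Y" and "0 \<le> s"
  shows "stays \<psi> z (s + t) Y"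
  unfolding stays_def
proof
  fix r assume r: "r \<in> {0..s + t}"
  show "r \<in> life \<psi> z \<and> run \<psi> z r \<in> Y"
  proof (cases "r \<le> s")
    case True
    then show ?thesis using a r by (auto simp: stays_def)
  next
    case False
    then have "r - s \<in> life \<psi> (run \<psi> z s)" "run \<psi> (run \<psi> z s) (r - s) \<in> Y"
      using b r by (auto simp: stays_def)
    moreover have "s \<in> life \<psi> z" using a assms(3) by (auto simp: stays_def)
    ultimately show ?thesis
      using life_add_iff[of s z "r - s"] run_add[of s z "r - s"] False by auto
  qed
qed

lemma stays_run_add:
  assumes "stays \<psi> z (s + t) Y" "0 \<le> s" "0 \<le> t"
  shows "run \<psi> z (s + t) = run \<psi> (run \<psi> z s) t"
proof (rule run_add)
  show "s \<in> life \<psi> z" by (rule stays_life[OF assms(1)]) (use assms in auto)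
  show "t \<in> life \<psi> (run \<psi> z s)"
    by (rule stays_life[OF stays_suffix[OF assms(1,2)]]) (use assms in auto)
qed

lemma no_blowup_stays:
  assumes "no_blowup_in \<psi> Y" "run \<psi> z ` life \<psi> z \<subseteq> Y"
  shows "stays \<psi> z T Y"
proof -
  have "life \<psi> z = {0..}" using assms unfolding no_blowup_in_def by blast
  then show ?thesis using assms(2) by (auto simp: stays_def)
qed

lemma no_blowup_in_subset: "no_blowup_in \<psi> Y \<Longrightarrow> Z \<subseteq> Y \<Longrightarrow> no_blowup_in \<psi> Z"
  unfolding no_blowup_in_def by blast

text \<open>The definition of a left solution says nothing past a blow-up time, and it permits an
  arbitrary domain. In a set without blow-up inside it both liberties disappear, and the maximal
  invariant set consists of the points on complete orbits in the set. In this form its invariance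
  and its monotonicity are evident, as a complete orbit may be shifted.\<close>

lemma max_inv_iff_orbit:
  assumes g: "no_blowup_in \<psi> Y"
  shows "z \<in> max_inv \<psi> Y \<longleftrightarrow>
    (\<exists>\<sigma>. \<sigma> 0 = z \<and> (\<forall>t. \<sigma> t \<in> Y) \<and>
         (\<forall>a b. 0 \<le> b \<longrightarrow> b \<in> life \<psi> (\<sigma> a) \<and> \<sigma> (a + b) = run \<psi> (\<sigma> a) b))"
    (is "?L \<longleftrightarrow> ?R")
proof
  assume ?R
  then obtain \<sigma> where s: "\<sigma> 0 = z" "\<And>t. \<sigma> t \<in> Y"
    "\<And>a b. 0 \<le> b \<Longrightarrow> b \<in> life \<psi> (\<sigma> a) \<and> \<sigma> (a + b) = run \<psi> (\<sigma> a) b" by blast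
  have "full_left_solution \<psi> UNIV \<sigma> z"
    using s by (simp add: full_left_solution_def)
  moreover have "run \<psi> z t \<in> Y" if "t \<in> life \<psi> z" for t
    using s(3)[of t 0] s(1,2) lifeD[OF that] by (metis add_0)
  moreover have "z \<in> Y" using s by metis
  ultimately show ?L
    using s unfolding max_inv_def inv_plus_def inv_minus_def by blast
next
  assume ?L
  then obtain J \<sigma> where zp: "run \<psi> z ` life \<psi> z \<subseteq> Y" and zY: "z \<in> Y"
    and fl: "full_left_solution \<psi> J \<sigma> z" and sY: "\<sigma> ` {..0} \<subseteq> Y"
    unfolding max_inv_def inv_plus_def inv_minus_def by blast
  have zl: "t \<in> life \<psi> z" "run \<psi> z t \<in> Y" if "0 \<le> t" for t
    using g zp that unfolding no_blowup_in_def by auto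
  have s0: "\<sigma> 0 = z" using fl by (simp add: full_left_solution_def)
  have step: "\<sigma> (t + s) = run \<psi> (\<sigma> t) s" if "t + s \<le> 0" "s \<in> life \<psi> (\<sigma> t)" for t s
  proof (cases "s = 0")
    case True then show ?thesis by (simp add: run_zero)
  next
    case False
    then have "0 < s" "ereal s < omega \<psi> (\<sigma> t)" using that by (auto simp: life_def)
    moreover have "t \<in> J" "t + s \<in> J"
      using fl that lifeD[OF that(2)] unfolding full_left_solution_def by auto
    ultimately show ?thesis using fl unfolding full_left_solution_def by blast
  qed
  \<comment> \<open>A left solution in \<open>Y\<close> cannot blow up, for the blowing-up orbit would lie in \<open>Y\<close>.\<close>
  have alive: "s \<in> life \<psi> (\<sigma> t)" if ts: "t + s \<le> 0" "0 \<le> s" for t s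
  proof (rule ccontr)
    assume n: "s \<notin> life \<psi> (\<sigma> t)"
    have "run \<psi> (\<sigma> t) r \<in> Y" if r: "r \<in> life \<psi> (\<sigma> t)" for r
    proof -
      have "r < s" using n r life_downward ts(2) by (metis not_le_imp_less)
      then have "\<sigma> (t + r) \<in> Y" "t + r \<le> 0" using sY ts by auto
      then show ?thesis using step[of t r] r by simp
    qed
    then have "life \<psi> (\<sigma> t) = {0..}" using g unfolding no_blowup_in_def by blast
    then show False using n ts by auto
  qed
  define \<rho> where "\<rho> t = (if t \<le> 0 then \<sigma> t else run \<psi> z t)" for t
  have "b \<in> life \<psi> (\<rho> a) \<and> \<rho> (a + b) = run \<psi> (\<rho> a) b" if b: "0 \<le> b" for a b
  proof (cases "a \<le> 0")
    case a: True
    show ?thesis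
    proof (cases "a + b \<le> 0")
      case True
      then show ?thesis using alive[OF True b] step[OF True] a by (simp add: \<rho>_def)
    next
      case False
      have m: "- a \<in> life \<psi> (\<sigma> a)" "run \<psi> (\<sigma> a) (- a) = z"
        using alive[of a "- a"] step[of a "- a"] a s0 by auto
      have "- a + (a + b) \<in> life \<psi> (\<sigma> a)"
        using life_add_iff[OF m(1), of "a + b"] m(2) zl[of "a + b"] False by auto
      moreover have "run \<psi> (\<sigma> a) (- a + (a + b)) = run \<psi> z (a + b)"
        using run_add[OF m(1), of "a + b"] m(2) zl[of "a + b"] False by auto
      ultimately show ?thesis using False a by (simp add: \<rho>_def)
    qed
  next
    case False
    then have "a \<in> life \<psi> z" "a + b \<in> life \<psi> z" using zl b by auto
    then show ?thesis
      using False b life_add_iff[of a z b] run_add[of a z b] by (auto simp: \<rho>_def)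
  qed
  moreover have "\<rho> t \<in> Y" for t using sY zl[of t] by (auto simp: \<rho>_def)
  moreover have "\<rho> 0 = z" by (simp add: \<rho>_def s0)
  ultimately show ?R by blast
qed

lemma max_inv_orbitE:
  assumes "no_blowup_in \<psi> Y" "z \<in> max_inv \<psi> Y"
  obtains \<sigma> where "\<sigma> 0 = z" "\<And>t. \<sigma> t \<in> Y"
    "\<And>a b. 0 \<le> b \<Longrightarrow> b \<in> life \<psi> (\<sigma> a) \<and> \<sigma> (a + b) = run \<psi> (\<sigma> a) b"
proof -
  obtain \<sigma> where "\<sigma> 0 = z \<and> (\<forall>t. \<sigma> t \<in> Y) \<and>
         (\<forall>a b. 0 \<le> b \<longrightarrow> b \<in> life \<psi> (\<sigma> a) \<and> \<sigma> (a + b) = run \<psi> (\<sigma> a) b)"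
    using assms(2) unfolding max_inv_iff_orbit[OF assms(1)] by (rule exE)
  then show ?thesis by (intro that[of \<sigma>]) simp_all
qed

lemma max_inv_sandwich:
  assumes g: "no_blowup_in \<psi> Y" and 1: "max_inv \<psi> Y \<subseteq> Z" and 2: "Z \<subseteq> Y"
  shows "max_inv \<psi> Z = max_inv \<psi> Y"
proof -
  note gZ = no_blowup_in_subset[OF g 2]
  have "max_inv \<psi> Z \<subseteq> max_inv \<psi> Y"
  proof
    fix z assume "z \<in> max_inv \<psi> Z"
    then obtain \<sigma> where "\<sigma> 0 = z" "\<And>t. \<sigma> t \<in> Z"
      "\<And>a b. 0 \<le> b \<Longrightarrow> b \<in> life \<psi> (\<sigma> a) \<and> \<sigma> (a + b) = run \<psi> (\<sigma> a) b"
      using max_inv_orbitE[OF gZ] by metis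
    then show "z \<in> max_inv \<psi> Y"
      unfolding max_inv_iff_orbit[OF g] using 2 by (intro exI[of _ \<sigma>]) auto
  qed
  moreover have "z \<in> max_inv \<psi> Z" if z: "z \<in> max_inv \<psi> Y" for z
  proof -
    obtain \<sigma> where s: "\<sigma> 0 = z" "\<And>t. \<sigma> t \<in> Y"
      "\<And>a b. 0 \<le> b \<Longrightarrow> b \<in> life \<psi> (\<sigma> a) \<and> \<sigma> (a + b) = run \<psi> (\<sigma> a) b"
      using max_inv_orbitE[OF g z] by metis
    have "\<sigma> t \<in> max_inv \<psi> Y" for t
      unfolding max_inv_iff_orbit[OF g]
      by (rule exI[of _ "\<lambda>r. \<sigma> (t + r)"]) (use s(2,3) in \<open>auto simp: add.assoc[symmetric]\<close>)
    then show ?thesis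
      unfolding max_inv_iff_orbit[OF gZ] using s 1 by blast
  qed
  ultimately show ?thesis by blast
qed

lemma max_inv_stays:
  assumes "no_blowup_in \<psi> Y" "z \<in> max_inv \<psi> Y"
  shows "stays \<psi> z T Y"
  by (rule no_blowup_stays) (use assms in \<open>auto simp: max_inv_def inv_plus_def\<close>)

lemma max_inv_past:
  assumes g: "no_blowup_in \<psi> Y" and z: "z \<in> max_inv \<psi> Y" and t: "0 \<le> t"
  obtains w where "stays \<psi> w t Y" "run \<psi> w t = z"
proof -
  obtain \<sigma> where s: "\<sigma> 0 = z" "\<And>t. \<sigma> t \<in> Y"
    "\<And>a b. 0 \<le> b \<Longrightarrow> b \<in> life \<psi> (\<sigma> a) \<and> \<sigma> (a + b) = run \<psi> (\<sigma> a) b"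
    using max_inv_orbitE[OF g z] by metis
  have "stays \<psi> (\<sigma> (- t)) t Y"
    unfolding stays_def using s(2,3) by (metis atLeastAtMost_iff)
  moreover have "run \<psi> (\<sigma> (- t)) t = z" using s(1) s(3)[OF t, of "- t"] by simp
  ultimately show ?thesis using that by blast
qed

text \<open>Unit steps backwards suffice: the pieces of orbit between consecutive points of the chain
  fit together to a left solution.\<close>

lemma max_inv_from_backward_chain:
  assumes g: "no_blowup_in \<psi> Y" and z: "run \<psi> z ` life \<psi> z \<subseteq> Y"
    and y0: "y 0 = z" and y: "\<And>m::nat. stays \<psi> (y (Suc m)) 1 Y \<and> run \<psi> (y (Suc m)) 1 = y m"
  shows "z \<in> max_inv \<psi> Y"
proof -
  have zl: "t \<in> life \<psi> z" "run \<psi> z t \<in> Y" if "0 \<le> t" for t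
    using g z that unfolding no_blowup_in_def by auto
  have chain: "t \<in> life \<psi> (y m) \<and> run \<psi> (y m) t \<in> Y" if "0 \<le> t" for t m
    using that
  proof (induction m arbitrary: t)
    case 0 then show ?case using zl y0 by simp
  next
    case (Suc m)
    have "stays \<psi> (run \<psi> (y (Suc m)) 1) t Y"
      using Suc.IH y unfolding stays_def by auto
    from stays_append[OF _ this] have "stays \<psi> (y (Suc m)) (1 + t) Y" using y by simp
    then show ?case using Suc.prems by (auto simp: stays_def)
  qed
  have shift: "run \<psi> (y (m + j)) (real j + t) = run \<psi> (y m) t" if "0 \<le> t" for t m j
  proof (induction j)
    case (Suc j)
    have "run \<psi> (y (Suc (m + j))) (1 + (real j + t)) = run \<psi> (run \<psi> (y (Suc (m + j))) 1) (real j + t)"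
      using that chain y by (intro run_add) auto
    then show ?case using Suc y by (simp add: add.assoc)
  qed simp
  define k where "k a = nat \<lceil>- a\<rceil>" for a :: real
  have k: "0 \<le> a + real (k a)" for a unfolding k_def by linarith
  define \<sigma> where "\<sigma> a = run \<psi> (y (k a)) (a + real (k a))" for a
  have "b \<in> life \<psi> (\<sigma> a) \<and> \<sigma> (a + b) = run \<psi> (\<sigma> a) b" if b: "0 \<le> b" for a b
  proof -
    have "k (a + b) \<le> k a" using b unfolding k_def by (intro nat_mono ceiling_mono) simp
    then obtain j where j: "k a = k (a + b) + j" using le_Suc_ex by blast
    have "\<sigma> (a + b) = run \<psi> (y (k a)) (real j + (a + b + real (k (a + b))))"
      unfolding \<sigma>_def j using k[of "a + b"] by (simp add: shift)
    also have "\<dots> = run \<psi> (y (k a)) (a + real (k a) + b)" by (simp add: j algebra_simps)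
    finally have "\<sigma> (a + b) = run \<psi> (y (k a)) (a + real (k a) + b)" .
    then show ?thesis
      using life_add_iff[of "a + real (k a)" "y (k a)" b] run_add[of "a + real (k a)" "y (k a)" b]
        chain[of "a + real (k a)"] chain[of "a + real (k a) + b"] k[of a] b
      by (auto simp: \<sigma>_def)
  qed
  moreover have "\<sigma> 0 = z" by (simp add: \<sigma>_def k_def y0 run_zero)
  moreover have "\<sigma> t \<in> Y" for t using chain k by (simp add: \<sigma>_def)
  ultimately show ?thesis unfolding max_inv_iff_orbit[OF g] by blast
qed

end

text \<open>Let \<open>D\<close> be positively invariant as long as orbits stay in \<open>B\<close>. The points of \<open>D\<close> that stay
  in \<open>B\<close> for time \<open>T\<close> form an index pair together with those among them that do not stay for the
  longer time \<open>T'\<close>. The remaining time in \<open>B\<close> decreases along orbits with unit speed. Hence the exit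
  set is relatively positively invariant, and an orbit that leaves \<open>N\<close> must use up its remaining
  time and thereby meets the values between \<open>T\<close> and \<open>T'\<close>, which are those on the exit set. The open
  set \<open>G\<close> witnesses that the invariant set lies inside \<open>N - L\<close>.\<close>

lemma index_pair_of_exit_times:
  fixes \<psi> :: "'z::topological_space pflow"
  assumes law: "semiflow_law \<psi>" and g: "no_blowup_in \<psi> Y" and T: "0 \<le> T" "T < T'"
    and N: "N = D \<inter> {z. stays \<psi> z T B}" and L: "L = N - {z. stays \<psi> z T' B}"
    and D: "\<And>z t. z \<in> D \<Longrightarrow> 0 \<le> t \<Longrightarrow> stays \<psi> z t B \<Longrightarrow> run \<psi> z t \<in> D"
    and M: "N \<subseteq> M" "M \<subseteq> Y" and iso: "isolating_neighborhood \<psi> M"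
    and G: "open G" "max_inv \<psi> Y \<subseteq> G" "G \<subseteq> N - L"
    and BY: "B \<subseteq> Y"
  shows "index_pair \<psi> M N L"
  unfolding index_pair_def
proof (intro conjI ballI impI)
  show "isolating_neighborhood \<psi> M" "L \<subseteq> N" "N \<subseteq> M" using iso L M by auto
  have c: "closed M" using iso by (simp add: isolating_neighborhood_def)
  have MM: "max_inv \<psi> M = max_inv \<psi> Y"
    by (rule max_inv_sandwich[OF law g]) (use G M in auto)
  show "max_inv \<psi> M \<subseteq> interior (N - L)"
    using MM G interior_maximal by blast
  have "closure (N - L) \<subseteq> M" using c M closure_minimal by (metis Diff_subset subset_trans)
  moreover have "max_inv \<psi> Y \<subseteq> closure (N - L)" using G closure_subset by blast
  ultimately have "max_inv \<psi> (closure (N - L)) = max_inv \<psi> Y"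
    by (intro max_inv_sandwich[OF law g]) (use M in auto)
  then show "max_inv \<psi> M = max_inv \<psi> (closure (N - L))" using MM by simp
next
  fix x e assume x: "x \<in> L" "e \<in> life \<psi> x" "run \<psi> x ` {0..e} \<subseteq> N"
  have NB: "N \<subseteq> B" using stays_in[OF law] T N by blast
  show "run \<psi> x ` {0..e} \<subseteq> L"
  proof (rule image_subsetI)
    fix r assume r: "r \<in> {0..e}"
    have a: "stays \<psi> x r B"
      using x(2,3) r NB life_downward[OF x(2)] unfolding stays_def by fastforce
    have "\<not> stays \<psi> (run \<psi> x r) T' B"
    proof
      assume "stays \<psi> (run \<psi> x r) T' B"
      then have "stays \<psi> x (r + T') B" using stays_append[OF law a] r by auto
      then have "stays \<psi> x T' B" by (rule stays_mono) (use r in auto)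
      then show False using x(1) L by blast
    qed
    then show "run \<psi> x r \<in> L" using x(3) r L by blast
  qed
next
  fix x assume x: "x \<in> N" and out: "\<not> run \<psi> x ` life \<psi> x \<subseteq> N"
  define d where "d = T' - T"
  have d: "d > 0" using T by (simp add: d_def)
  have mv: "run \<psi> x t \<in> N" if "stays \<psi> x (t + T) B" "0 \<le> t" for t
    using D[of x t] x stays_suffix[OF law that] stays_mono[OF that(1), of t B] that(2) T N by auto
  \<comment> \<open>Moving in steps of length \<open>T' - T\<close>, the orbit cannot jump over the exit set.\<close>
  have ex: "\<exists>k::nat. \<not> stays \<psi> x (T' + real k * d) B"
  proof (rule ccontr)
    assume "\<not> ?thesis"
    then have all: "stays \<psi> x (T' + real k * d) B" for k :: nat by blast
    have "run \<psi> x ` life \<psi> x \<subseteq> N"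
    proof (rule image_subsetI)
      fix t assume t: "t \<in> life \<psi> x"
      obtain k :: nat where "t < real k * d" using d reals_Archimedean3 by blast
      then have "stays \<psi> x (t + T) B" using stays_mono[OF all[of k], of "t + T" B] T by auto
      then show "run \<psi> x t \<in> N" using mv lifeD[OF t] by simp
    qed
    then show False using out by simp
  qed
  define k where "k = (LEAST k::nat. \<not> stays \<psi> x (T' + real k * d) B)"
  have k: "\<not> stays \<psi> x (T' + real k * d) B" unfolding k_def using LeastI_ex[OF ex] .
  have st: "stays \<psi> x (real k * d + T) B"
  proof (cases k)
    case 0 then show ?thesis using x N by simp
  next
    case (Suc j)
    then have "j < k" by simp
    then have "stays \<psi> x (T' + real j * d) B" unfolding k_def using not_less_Least by blast
    then show ?thesis using Suc by (simp add: d_def algebra_simps)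
  qed
  have kd: "0 \<le> real k * d" using d by simp
  have "\<not> stays \<psi> (run \<psi> x (real k * d)) T' B"
    using stays_append[OF law stays_mono[OF st _ order_refl], of "real k * d" T'] k kd T
    by (auto simp: add.commute)
  then have "run \<psi> x (real k * d) \<in> L" using mv[OF st kd] L by blast
  moreover have "real k * d \<in> life \<psi> x" using stays_life[OF st kd] T by simp
  ultimately show "\<exists>t\<in>life \<psi> x. run \<psi> x t \<in> L" by blast
qed

section \<open>Sequences of indices and neighbourhoods of compact sets\<close>

text \<open>The limit flow has index \<open>0\<close>. A compactness argument for the whole family leads to a sequence of
  indices which, after thinning, either is constantly \<open>0\<close> or tends strictly to infinity. In both
  cases the flows along the sequence converge to the limit flow.\<close>

definition index_sequence :: "(nat \<Rightarrow> nat) \<Rightarrow> bool" where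
  "index_sequence n \<longleftrightarrow> (\<forall>k. n k = 0) \<or> (strict_mono n \<and> (\<forall>k. 1 \<le> n k))"

lemma index_sequence_zero: "index_sequence (\<lambda>_. 0)"
  by (simp add: index_sequence_def)

lemma index_sequence_subseq: "index_sequence n \<Longrightarrow> strict_mono r \<Longrightarrow> index_sequence (n \<circ> r)"
  unfolding index_sequence_def using strict_mono_o by (metis comp_apply)

lemma index_sequence_extract:
  assumes n: "\<And>k. n k = 0 \<or> k \<le> n k"
  shows "\<exists>r. strict_mono r \<and> index_sequence (n \<circ> r)"
proof (cases "infinite {k. n k = 0}")
  case True
  then obtain r :: "nat \<Rightarrow> nat" where "strict_mono r" "\<And>k. r k \<in> {k. n k = 0}"
    using infinite_enumerate by blast
  then show ?thesis unfolding index_sequence_def by auto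
next
  case False
  then have "\<exists>K. \<forall>k\<in>{k. n k = 0}. k < K"
    by (subst finite_nat_set_iff_bounded[symmetric]) simp
  then obtain K where K: "\<And>k. n k = 0 \<Longrightarrow> k < K" by blast
  have "\<exists>r. \<forall>i. 1 \<le> n (r i) \<and> (r i < r (Suc i) \<and> n (r i) < n (r (Suc i)))"
  proof (rule dependent_nat_choice)
    show "\<exists>x. 1 \<le> n x" using K[of K] by (metis less_irrefl_nat not_less_eq_eq less_one not_less)
  next
    fix x i assume "1 \<le> n x"
    define y where "y = K + x + n x + 1"
    have "n y \<noteq> 0" using K[of y] by (auto simp: y_def)
    then have "y \<le> n y" using n[of y] by simp
    then show "\<exists>y. 1 \<le> n y \<and> x < y \<and> n x < n y"
      by (intro exI[of _ y]) (auto simp: y_def)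
  qed
  then obtain r where r: "\<And>i. 1 \<le> n (r i)" "\<And>i. r i < r (Suc i)" "\<And>i. n (r i) < n (r (Suc i))"
    by blast
  then have "strict_mono r" "strict_mono (n \<circ> r)"
    by (auto intro: strict_monoI_Suc)
  then show ?thesis using r unfolding index_sequence_def by auto
qed

lemma bounded_or_unbounded_subseq:
  fixes t :: "nat \<Rightarrow> real"
  assumes "\<And>k. 0 \<le> t k"
  obtains (bounded) r t0 where "strict_mono r" "(t \<circ> r) \<longlonglongrightarrow> t0"
  | (unbounded) r where "strict_mono r" "\<And>k. real k \<le> t (r k)"
proof (cases "\<exists>M. \<forall>k. t k \<le> M")
  case True
  then obtain M where M: "\<And>k. t k \<le> M" by blast
  have "compact {0..M}" by simp
  then obtain t0 r where "strict_mono r" "(t \<circ> r) \<longlonglongrightarrow> t0"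
    using assms M unfolding compact_eq_seq_compact_metric seq_compact_def
    by (metis atLeastAtMost_iff)
  then show ?thesis using bounded by blast
next
  case False
  have "\<exists>r. \<forall>i. real i \<le> t (r i) \<and> r i < r (Suc i)"
  proof (rule dependent_nat_choice)
    show "\<exists>x. real 0 \<le> t x" using assms by auto
  next
    fix x i
    define M where "M = Max (insert (real (Suc i)) (t ` {..x}))"
    have M: "real (Suc i) \<le> M" "\<And>j. j \<le> x \<Longrightarrow> t j \<le> M"
      unfolding M_def by (rule Max_ge; simp)+
    obtain y where y: "M < t y" using False not_le by blast
    have "x < y" using M(2)[of y] y by (metis not_le)
    then show "\<exists>y. real (Suc i) \<le> t y \<and> x < y" using M(1) y by (intro exI[of _ y]) auto
  qed
  then show ?thesis using unbounded strict_monoI_Suc by metis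
qed

text \<open>A neighbourhood base of a compact set, indexed so that one natural number can measure
  both the size of the neighbourhood and the position in the sequence of flows. As a union of balls
  it is empty for empty \<open>A\<close>, where the infimum distance would be useless.\<close>

definition near :: "'a::metric_space set \<Rightarrow> nat \<Rightarrow> 'a set" where
  "near A k = (\<Union>a\<in>A. cball a (1 / real (Suc k)))"

lemma near_antimono: "j \<le> k \<Longrightarrow> near A k \<subseteq> near A j"
  unfolding near_def by (intro UN_mono subset_cball) (auto simp: field_simps)

lemma near_mono: "A \<subseteq> B \<Longrightarrow> near A k \<subseteq> near B k"
  unfolding near_def by blast

lemma near_interior: "j < k \<Longrightarrow> near A k \<subseteq> interior (near A j)"
proof -
  assume "j < k"
  then have "1 / real (Suc k) < 1 / real (Suc j)" by (simp add: field_simps)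
  then have "near A k \<subseteq> (\<Union>a\<in>A. ball a (1 / real (Suc j)))"
    unfolding near_def by (intro UN_mono) auto
  also have "\<dots> \<subseteq> interior (near A j)"
    unfolding near_def by (intro interior_maximal UN_mono open_UN) auto
  finally show ?thesis .
qed

lemma near_compact_subseq:
  assumes A: "compact A" and x: "\<And>k. x k \<in> near A k"
  obtains r a where "strict_mono r" "a \<in> A" "(x \<circ> r) \<longlonglongrightarrow> a"
proof -
  have "\<forall>k. \<exists>a. a \<in> A \<and> dist a (x k) \<le> 1 / real (Suc k)"
    using x unfolding near_def by (metis UN_E mem_cball)
  then obtain c where c: "\<And>k. c k \<in> A" "\<And>k. dist (c k) (x k) \<le> 1 / real (Suc k)" by metis
  obtain a r where r: "a \<in> A" "strict_mono r" "(c \<circ> r) \<longlonglongrightarrow> a"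
    using A c(1) unfolding compact_eq_seq_compact_metric seq_compact_def by metis
  have "(\<lambda>k. dist (c k) (x k)) \<longlonglongrightarrow> 0"
    by (rule tendsto_sandwich[OF _ _ tendsto_const lim_1_over_n[THEN LIMSEQ_Suc]])
       (use c(2) in \<open>auto intro!: always_eventually\<close>)
  then have d: "(\<lambda>k. dist (c (r k)) (x (r k))) \<longlonglongrightarrow> 0"
    using LIMSEQ_subseq_LIMSEQ[OF _ r(2)] by (auto simp: o_def)
  then have "(x \<circ> r) \<longlonglongrightarrow> a"
  proof -
    have "(\<lambda>k. dist (c (r k)) a) \<longlonglongrightarrow> 0"
      using r(3) unfolding o_def by (rule tendsto_dist_iff[THEN iffD1])
    with d have "(\<lambda>k. dist (c (r k)) (x (r k)) + dist (c (r k)) a) \<longlonglongrightarrow> 0 + 0"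
      by (rule tendsto_add)
    then have H: "(\<lambda>k. dist (c (r k)) (x (r k)) + dist (c (r k)) a) \<longlonglongrightarrow> 0" by simp
    have "(\<lambda>k. dist (x (r k)) a) \<longlonglongrightarrow> 0"
      by (rule tendsto_sandwich[OF _ _ tendsto_const H]) (auto intro!: always_eventually dist_triangle3)
    then show ?thesis by (simp add: o_def tendsto_dist_iff[symmetric])
  qed
  then show ?thesis using that r by blast
qed

lemma closed_near: "compact A \<Longrightarrow> closed (near A k)"
  unfolding closed_sequential_limits
proof (intro allI impI, elim conjE)
  fix x l assume A: "compact A" and x: "\<forall>n. x n \<in> near A k" and l: "x \<longlonglongrightarrow> l"
  have "\<forall>n. \<exists>a. a \<in> A \<and> dist a (x n) \<le> 1 / real (Suc k)"
    using x unfolding near_def by (metis UN_E mem_cball)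
  then obtain c where c: "\<And>n. c n \<in> A" "\<And>n. dist (c n) (x n) \<le> 1 / real (Suc k)" by metis
  obtain a r where r: "a \<in> A" "strict_mono r" "(c \<circ> r) \<longlonglongrightarrow> a"
    using A c(1) unfolding compact_eq_seq_compact_metric seq_compact_def by metis
  have "(\<lambda>n. dist ((c \<circ> r) n) ((x \<circ> r) n)) \<longlonglongrightarrow> dist a l"
    using r(3) LIMSEQ_subseq_LIMSEQ[OF l r(2)] by (intro tendsto_dist)
  then have "dist a l \<le> 1 / real (Suc k)"
    by (rule LIMSEQ_le_const2) (use c(2) in auto)
  then show "l \<in> near A k" using r(1) unfolding near_def by auto
qed

section \<open>The unstable set and the invariant set of the limit flow\<close>

text \<open>The limit flow \<open>\<phi> 0\<close> on the product lives over \<open>\<pi>0\<close>; convergence and admissibility are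
  required along index sequences, so that the limit flow and its approximations are treated alike.\<close>

locale semi_singular_limit =
  fixes \<pi>0 :: "'x::metric_space pflow"
    and \<phi> :: "nat \<Rightarrow> (real \<times> 'x) pflow"
    and Nt :: "'x set"
  assumes closed_Nt: "closed Nt"
    and law: "\<And>n. semiflow_law (\<phi> n)"
    and law0: "semiflow_law \<pi>0"
    and life_index_zero: "\<And>s x. life (\<phi> 0) (s, x) = life \<pi>0 x"
    and run_index_zero: "\<And>s x t. t \<in> life \<pi>0 x \<Longrightarrow> run (\<phi> 0) (s, x) t = (s + t, run \<pi>0 x t)"
    and converges: "\<And>n s x t x0 t0. index_sequence n \<Longrightarrow> \<forall>k. 0 \<le> t k \<Longrightarrow>
        x \<longlonglongrightarrow> x0 \<Longrightarrow> t \<longlonglongrightarrow> t0 \<Longrightarrow> t0 \<in> life \<pi>0 x0 \<Longrightarrow>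
        (\<forall>\<^sub>F k in sequentially. t k \<in> life (\<phi> (n k)) (s k, x k)) \<and>
        (\<lambda>k. snd (run (\<phi> (n k)) (s k, x k) (t k))) \<longlonglongrightarrow> run \<pi>0 x0 t0"
    and admissible: "\<And>n z t. index_sequence n \<Longrightarrow>
        \<forall>k. 0 \<le> t k \<and> stays (\<phi> (n k)) (z k) (t k) (UNIV \<times> Nt) \<Longrightarrow>
        filterlim t at_top sequentially \<Longrightarrow>
        \<exists>r l. strict_mono r \<and> (\<lambda>k. snd (run (\<phi> (n (r k))) (z (r k)) (t (r k)))) \<longlonglongrightarrow> l"
    and no_blowup: "\<And>n. no_blowup_in (\<phi> n) (UNIV \<times> Nt)"
    and no_blowup0: "no_blowup_in \<pi>0 Nt"
begin

lemma stays_index_zero: "stays (\<phi> 0) (s, x) T (UNIV \<times> Y) \<longleftrightarrow> stays \<pi>0 x T Y"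
  unfolding stays_def by (auto simp: life_index_zero run_index_zero)

text \<open>Staying in a closed subset of \<open>Nt\<close> passes to limits. The point to check is that the
  limit orbit is defined: before a blow-up it would lie in \<open>Nt\<close>, where no blow-up happens.\<close>

lemma stays_limit:
  assumes n: "index_sequence n" and x: "x \<longlonglongrightarrow> x0" and T: "T \<longlonglongrightarrow> T0"
    and st: "\<And>k. 0 \<le> T k \<and> stays (\<phi> (n k)) (s k, x k) (T k) (UNIV \<times> Y)"
    and Y: "closed Y" "Y \<subseteq> Nt"
  shows "stays \<pi>0 x0 T0 Y"
proof -
  have in_Y: "run \<pi>0 x0 t \<in> Y" if t: "t \<in> life \<pi>0 x0" "t \<le> T0" for t
  proof -
    have t0: "0 \<le> t" using lifeD[OF t(1)] .
    have "(\<lambda>k. min t (T k)) \<longlonglongrightarrow> min t T0" by (intro tendsto_min tendsto_const T)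
    then have "(\<lambda>k. min t (T k)) \<longlonglongrightarrow> t" using t by (simp add: min_def)
    then have L: "(\<lambda>k. snd (run (\<phi> (n k)) (s k, x k) (min t (T k)))) \<longlonglongrightarrow> run \<pi>0 x0 t"
      using converges[OF n _ x _ t(1), of "\<lambda>k. min t (T k)"] t0 st by auto
    have "snd (run (\<phi> (n k)) (s k, x k) (min t (T k))) \<in> Y" for k
      using stays_run[of "\<phi> (n k)" "(s k, x k)" "T k" "UNIV \<times> Y" "min t (T k)"] st[of k] t0 by auto
    then show ?thesis by (rule closed_sequentially[OF Y(1) _ L])
  qed
  \<comment> \<open>A blow-up before time \<open>T0\<close> would happen inside \<open>Nt\<close>.\<close>
  have "t \<in> life \<pi>0 x0" if t: "0 \<le> t" "t \<le> T0" for t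
  proof (rule ccontr)
    assume nt: "t \<notin> life \<pi>0 x0"
    have "run \<pi>0 x0 ` life \<pi>0 x0 \<subseteq> Nt"
    proof (rule image_subsetI)
      fix r assume r: "r \<in> life \<pi>0 x0"
      have "r < t" using nt r life_downward t(1) by (metis not_le_imp_less)
      then show "run \<pi>0 x0 r \<in> Nt" using in_Y[OF r] t Y by auto
    qed
    then have "life \<pi>0 x0 = {0..}" using no_blowup0 unfolding no_blowup_in_def by blast
    then show False using nt t by auto
  qed
  then show ?thesis using in_Y by (simp add: stays_def)
qed

text \<open>Convergence is only along sequences of times, but violations at times in \<open>[0, T]\<close> accumulate
  by compactness, so that staying in an open set is inherited by some approximation.\<close>

lemma stays_nearby:
  assumes n: "index_sequence n" and x: "x \<longlonglongrightarrow> x0"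
    and st: "stays \<pi>0 x0 T U" and U: "open U"
  shows "\<exists>k. stays (\<phi> (n k)) (s k, x k) T (UNIV \<times> U)"
proof (rule ccontr)
  assume "\<nexists>k. stays (\<phi> (n k)) (s k, x k) T (UNIV \<times> U)"
  then have "\<forall>k. \<exists>t\<in>{0..T}.
      \<not> (t \<in> life (\<phi> (n k)) (s k, x k) \<and> snd (run (\<phi> (n k)) (s k, x k) t) \<in> U)"
    unfolding stays_def mem_Times_iff by simp
  then obtain t where t: "\<And>k. t k \<in> {0..T}"
    "\<And>k. \<not> (t k \<in> life (\<phi> (n k)) (s k, x k) \<and> snd (run (\<phi> (n k)) (s k, x k) (t k)) \<in> U)"
    by metis
  obtain t0 r where r: "t0 \<in> {0..T}" "strict_mono r" "(t \<circ> r) \<longlonglongrightarrow> t0"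
    using compact_Icc[of 0 T] t(1) unfolding compact_eq_seq_compact_metric seq_compact_def by metis
  have l0: "t0 \<in> life \<pi>0 x0" "run \<pi>0 x0 t0 \<in> U" using st r(1) by (auto simp: stays_def)
  have c: "(\<forall>\<^sub>F k in sequentially. (t \<circ> r) k \<in> life (\<phi> ((n \<circ> r) k)) ((s \<circ> r) k, (x \<circ> r) k)) \<and>
        (\<lambda>k. snd (run (\<phi> ((n \<circ> r) k)) ((s \<circ> r) k, (x \<circ> r) k) ((t \<circ> r) k))) \<longlonglongrightarrow> run \<pi>0 x0 t0"
    by (rule converges[OF index_sequence_subseq[OF n r(2)] _ LIMSEQ_subseq_LIMSEQ[OF x r(2)] r(3) l0(1)])
       (use t(1) in auto)
  have "\<forall>\<^sub>F k in sequentially. (t \<circ> r) k \<in> life (\<phi> ((n \<circ> r) k)) ((s \<circ> r) k, (x \<circ> r) k) \<and>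
      snd (run (\<phi> ((n \<circ> r) k)) ((s \<circ> r) k, (x \<circ> r) k) ((t \<circ> r) k)) \<in> U"
    using c topological_tendstoD[OF conjunct2[OF c] U l0(2)] by (intro eventually_conj) auto
  then obtain k where "(t \<circ> r) k \<in> life (\<phi> ((n \<circ> r) k)) ((s \<circ> r) k, (x \<circ> r) k) \<and>
      snd (run (\<phi> ((n \<circ> r) k)) ((s \<circ> r) k, (x \<circ> r) k) ((t \<circ> r) k)) \<in> U"
    using eventually_happens'[OF sequentially_bot] by blast
  then show False using t(2)[of "r k"] by simp
qed

text \<open>This is the set \<open>A\<^sup>-\<close> of the limit flow in \<open>Nt\<close>, described as the set of all limits of
  orbits of members of the family that stay in \<open>Nt\<close> for times tending to infinity. With this
  description compactness is immediate from admissibility and no diagonal sequence is needed to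
  produce left solutions: a unit step back along the approximating orbits leads to another such
  limit.\<close>

definition unstable :: "'x set" where
  "unstable = {l. \<exists>n z t. index_sequence n \<and>
     (\<forall>k. real k \<le> t k \<and> stays (\<phi> (n k)) (z k) (t k) (UNIV \<times> Nt)) \<and>
     (\<lambda>k. snd (run (\<phi> (n k)) (z k) (t k))) \<longlonglongrightarrow> l}"

text \<open>All noncompactness is lost along orbits that stay in \<open>Nt\<close> for a long time.\<close>

lemma unstable_subseq:
  assumes n: "index_sequence n"
    and st: "\<And>k. real k \<le> t k \<and> stays (\<phi> (n k)) (z k) (t k) (UNIV \<times> Nt)"
  obtains r l where "strict_mono r" "l \<in> unstable"
    "(\<lambda>k. snd (run (\<phi> (n (r k))) (z (r k)) (t (r k)))) \<longlonglongrightarrow> l"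
proof -
  have "filterlim t at_top sequentially"
    by (rule filterlim_at_top_mono[OF filterlim_real_sequentially]) (use st in auto)
  moreover have "\<forall>k. 0 \<le> t k \<and> stays (\<phi> (n k)) (z k) (t k) (UNIV \<times> Nt)"
    using st by (metis of_nat_0_le_iff order_trans)
  ultimately obtain r l where r: "strict_mono r"
    "(\<lambda>k. snd (run (\<phi> (n (r k))) (z (r k)) (t (r k)))) \<longlonglongrightarrow> l"
    using admissible[OF n] by blast
  have "real k \<le> t (r k)" for k
    using st[of "r k"] seq_suble[OF r(1), of k] by (meson of_nat_le_iff order_trans)
  then have "l \<in> unstable"
    unfolding unstable_def using r index_sequence_subseq[OF n r(1)] st
    by (intro CollectI exI[of _ "n \<circ> r"] exI[of _ "z \<circ> r"] exI[of _ "t \<circ> r"]) auto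
  then show ?thesis using that r by blast
qed

text \<open>Stopping the approximating orbits one unit of time earlier gives, by admissibility, a
  convergent sequence, whose limit is carried to \<open>l\<close> by convergence of the flows.\<close>

lemma unstable_step_back:
  assumes "l \<in> unstable"
  obtains w where "w \<in> unstable" "stays \<pi>0 w 1 Nt" "run \<pi>0 w 1 = l"
proof -
  obtain n z t where n: "index_sequence n"
    and st: "\<And>k. real k \<le> t k \<and> stays (\<phi> (n k)) (z k) (t k) (UNIV \<times> Nt)"
    and lim: "(\<lambda>k. snd (run (\<phi> (n k)) (z k) (t k))) \<longlonglongrightarrow> l"
    using assms unfolding unstable_def by blast
  have sS: "strict_mono Suc" by (simp add: strict_mono_Suc_iff)
  define t' where "t' k = t (Suc k) - 1" for k
  have t': "real k \<le> t' k" for k using st[of "Suc k"] by (simp add: t'_def)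
  have nS: "index_sequence (\<lambda>k. n (Suc k))" using index_sequence_subseq[OF n sS] by (simp add: o_def)
  have "stays (\<phi> (n (Suc k))) (z (Suc k)) (t' k) (UNIV \<times> Nt)" for k
    using st[of "Suc k"] by (auto simp: t'_def intro: stays_mono)
  then obtain r w where r: "strict_mono r" and w: "w \<in> unstable"
    and lw: "(\<lambda>k. snd (run (\<phi> (n (Suc (r k)))) (z (Suc (r k))) (t' (r k)))) \<longlonglongrightarrow> w"
    using unstable_subseq[OF nS, of t' "\<lambda>k. z (Suc k)"] t' by blast
  define m where "m k = n (Suc (r k))" for k
  have m: "index_sequence m" using index_sequence_subseq[OF nS r] by (simp add: o_def m_def[abs_def])
  define y where "y k = run (\<phi> (m k)) (z (Suc (r k))) (t' (r k))" for k
  have tt: "0 \<le> t' k" for k using t'[of k] by linarith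
  have st2: "stays (\<phi> (m k)) (z (Suc (r k))) (t' (r k) + 1) (UNIV \<times> Nt)" for k
    using st[of "Suc (r k)"] by (simp add: t'_def m_def)
  have y1: "stays (\<phi> (m k)) (y k) 1 (UNIV \<times> Nt)" for k
    unfolding y_def by (rule stays_suffix[OF law st2 tt])
  have y2: "run (\<phi> (m k)) (y k) 1 = run (\<phi> (n (Suc (r k)))) (z (Suc (r k))) (t (Suc (r k)))" for k
    unfolding y_def using stays_run_add[OF law st2 tt, of k] by (simp add: t'_def m_def)
  have ly: "(\<lambda>k. snd (y k)) \<longlonglongrightarrow> w" using lw by (simp add: y_def m_def)
  have w1: "stays \<pi>0 w 1 Nt"
    by (rule stays_limit[OF m ly tendsto_const, where s = "\<lambda>k. fst (y k)"]) (use y1 closed_Nt in auto)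
  have "(\<lambda>k. snd (run (\<phi> (m k)) (fst (y k), snd (y k)) 1)) \<longlonglongrightarrow> run \<pi>0 w 1"
    using converges[OF m _ ly tendsto_const stays_life[OF w1], where s = "\<lambda>k. fst (y k)"] by simp
  moreover have "(\<lambda>k. snd (run (\<phi> (m k)) (fst (y k), snd (y k)) 1)) \<longlonglongrightarrow> l"
    using LIMSEQ_subseq_LIMSEQ[OF lim strict_mono_o[OF sS r]] by (simp add: y2 o_def)
  ultimately have "run \<pi>0 w 1 = l" using LIMSEQ_unique by blast
  then show ?thesis using that w w1 by blast
qed

lemma unstable_past:
  assumes "l \<in> unstable"
  shows "\<exists>w\<in>unstable. stays \<pi>0 w (real m) Nt \<and> run \<pi>0 w (real m) = l"
  using assms
proof (induction m arbitrary: l)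
  case 0
  obtain w where w: "stays \<pi>0 w 1 Nt" "run \<pi>0 w 1 = l" using unstable_step_back[OF 0] by blast
  then have "l \<in> Nt" using stays_run[OF w(1), of 1] by simp
  then show ?case using 0 by (intro bexI[of _ l]) (auto simp: stays_zero[OF law0] run_zero[OF law0])
next
  case (Suc m)
  obtain w where w: "w \<in> unstable" "stays \<pi>0 w 1 Nt" "run \<pi>0 w 1 = l"
    using unstable_step_back[OF Suc.prems] by blast
  obtain v where v: "v \<in> unstable" "stays \<pi>0 v (real m) Nt" "run \<pi>0 v (real m) = w"
    using Suc.IH[OF w(1)] by blast
  have st: "stays \<pi>0 v (real m + 1) Nt" using stays_append[OF law0 v(2)] v(3) w(2) by simp
  then have "run \<pi>0 v (real m + 1) = l" using stays_run_add[OF law0 st] v(3) w(3) by simp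
  then show ?case using v(1) st by (intro bexI[of _ v]) (auto simp: add.commute)
qed

lemma unstable_forward:
  assumes l: "l \<in> unstable" and t: "0 \<le> t" and st: "stays \<pi>0 l t Nt"
  shows "run \<pi>0 l t \<in> unstable"
proof -
  obtain w where w: "\<And>m::nat. stays \<pi>0 (w m) (real m) Nt \<and> run \<pi>0 (w m) (real m) = l"
    using unstable_past[OF l] by metis
  have a: "stays \<pi>0 (w m) (real m + t) Nt" for m
    using stays_append[OF law0, of "w m" "real m" Nt t] w st by auto
  have b: "run \<pi>0 (w m) (real m + t) = run \<pi>0 l t" for m
    using stays_run_add[OF law0 a] w t by auto
  have c: "real m + t \<in> life \<pi>0 (w m)" for m using stays_life[OF a] t by auto
  show ?thesis
    unfolding unstable_def
    by (intro CollectI exI[of _ "\<lambda>_. 0"] exI[of _ "\<lambda>m. (0, w m)"] exI[of _ "\<lambda>m. real m + t"])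
       (use a b c t in \<open>auto simp: index_sequence_zero stays_index_zero run_index_zero\<close>)
qed

lemma compact_unstable: "compact unstable"
  unfolding compact_eq_seq_compact_metric seq_compact_def
proof (intro allI impI)
  fix x :: "nat \<Rightarrow> 'x" assume x: "\<forall>k. x k \<in> unstable"
  have "\<forall>k. \<exists>w. stays \<pi>0 w (real k) Nt \<and> run \<pi>0 w (real k) = x k"
    using unstable_past x by blast
  then obtain w where w: "\<And>k. stays \<pi>0 (w k) (real k) Nt" "\<And>k. run \<pi>0 (w k) (real k) = x k"
    by metis
  obtain r l where r: "strict_mono r" "l \<in> unstable"
    "(\<lambda>k. snd (run (\<phi> 0) (0, w (r k)) (real (r k)))) \<longlonglongrightarrow> l"
    using unstable_subseq[OF index_sequence_zero, of real "\<lambda>k. (0, w k)"] w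
    by (auto simp: stays_index_zero)
  have "snd (run (\<phi> 0) (0, w k) (real k)) = x k" for k
    using w stays_life[OF w(1), of k k] by (simp add: run_index_zero)
  then have "(x \<circ> r) \<longlonglongrightarrow> l" using r(3) by (simp add: o_def)
  then show "\<exists>l\<in>unstable. \<exists>r. strict_mono r \<and> (x \<circ> r) \<longlonglongrightarrow> l" using r by blast
qed

text \<open>Orbits that start close to the unstable set end close to it, for any duration spent in \<open>Nt\<close>:
  if the durations are bounded, then the limit is a point on an orbit in the unstable set, and
  otherwise the limit belongs to the unstable set by its definition.\<close>

lemma unstable_attracts:
  assumes n: "index_sequence n" and x: "x \<longlonglongrightarrow> x0" and x0: "x0 \<in> unstable"
    and st: "\<And>k. 0 \<le> t k \<and> stays (\<phi> (n k)) (s k, x k) (t k) (UNIV \<times> Nt)"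
  obtains r l where "strict_mono r" "l \<in> unstable"
    "(\<lambda>k. snd (run (\<phi> (n (r k))) (s (r k), x (r k)) (t (r k)))) \<longlonglongrightarrow> l"
proof -
  have tpos: "\<And>k. 0 \<le> t k" using st by blast
  show ?thesis
  proof (rule bounded_or_unbounded_subseq[of t])
    show "0 \<le> t k" for k by (rule tpos)
  next
    fix r t0 assume bounded: "strict_mono r" "(t \<circ> r) \<longlonglongrightarrow> t0"
    have nr: "index_sequence (\<lambda>k. n (r k))"
      using index_sequence_subseq[OF n bounded(1)] by (simp add: o_def)
    have xr: "(\<lambda>k. x (r k)) \<longlonglongrightarrow> x0" using LIMSEQ_subseq_LIMSEQ[OF x bounded(1)] by (simp add: o_def)
    have tr: "(\<lambda>k. t (r k)) \<longlonglongrightarrow> t0" using bounded(2) by (simp add: o_def)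
    have "0 \<le> t0" by (rule LIMSEQ_le_const[OF tr]) (use tpos in auto)
    moreover have s0: "stays \<pi>0 x0 t0 Nt"
      by (rule stays_limit[OF nr xr tr, where s = "\<lambda>k. s (r k)"]) (use st closed_Nt in auto)
    ultimately have "run \<pi>0 x0 t0 \<in> unstable" "t0 \<in> life \<pi>0 x0"
      using unstable_forward[OF x0] stays_life[OF s0] by auto
    moreover have "(\<lambda>k. snd (run (\<phi> (n (r k))) (s (r k), x (r k)) (t (r k)))) \<longlonglongrightarrow> run \<pi>0 x0 t0"
      using converges[OF nr _ xr tr, where s = "\<lambda>k. s (r k)"] tpos calculation(2) by simp
    ultimately show ?thesis using that bounded(1) by blast
  next
    fix r assume unbounded: "strict_mono r" "\<And>k. real k \<le> t (r k)"
    have nr: "index_sequence (\<lambda>k. n (r k))"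
      using index_sequence_subseq[OF n unbounded(1)] by (simp add: o_def)
    obtain q l where q: "strict_mono q" "l \<in> unstable"
      "(\<lambda>k. snd (run (\<phi> (n (r (q k)))) (s (r (q k)), x (r (q k))) (t (r (q k))))) \<longlonglongrightarrow> l"
      using unstable_subseq[OF nr, of "\<lambda>k. t (r k)" "\<lambda>k. (s (r k), x (r k))"] unbounded(2) st by blast
    then show ?thesis using that[of "r \<circ> q" l] strict_mono_o[OF unbounded(1) q(1)] by simp
  qed
qed

text \<open>Points with a past and a future in \<open>Nt\<close>. They belong to the maximal invariant set of \<open>\<pi>0\<close>
  (\<open>core_subset_max_inv\<close>), through which the hypothesis of isolation enters.\<close>

definition core :: "'x set" where
  "core = {x \<in> unstable. \<forall>T. stays \<pi>0 x T Nt}"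

lemma core_forward:
  assumes "x \<in> core" "0 \<le> t"
  shows "t \<in> life \<pi>0 x \<and> run \<pi>0 x t \<in> core"
  using assms unstable_forward[of x t] stays_life[of \<pi>0 x t Nt t] stays_suffix[OF law0, of x t _ Nt]
  by (auto simp: core_def)

lemma core_stays: "x \<in> core \<Longrightarrow> core \<subseteq> U \<Longrightarrow> stays \<pi>0 x T U"
  using core_forward by (auto simp: stays_def)

lemma core_limit:
  assumes n: "index_sequence n" and x: "x \<longlonglongrightarrow> x0" and x0: "x0 \<in> unstable"
    and st: "\<And>k. stays (\<phi> (n k)) (s k, x k) (real k) (UNIV \<times> Nt)"
  shows "x0 \<in> core"
proof -
  have "stays \<pi>0 x0 T Nt" for T
  proof -
    define m where "m = nat \<lceil>T\<rceil>"
    have sm: "strict_mono (\<lambda>k. k + m)" by (simp add: strict_mono_def)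
    have a: "stays \<pi>0 x0 (real m) Nt"
    proof (rule stays_limit[OF index_sequence_subseq[OF n sm] LIMSEQ_subseq_LIMSEQ[OF x sm] tendsto_const])
      show "0 \<le> real m \<and> stays (\<phi> ((n \<circ> (\<lambda>k. k + m)) k)) (s (k + m), (x \<circ> (\<lambda>k. k + m)) k) (real m) (UNIV \<times> Nt)" for k
        using stays_mono[OF st[of "k + m"], of "real m"] by auto
    qed (use closed_Nt in auto)
    have "T \<le> real m" unfolding m_def by linarith
    then show ?thesis using stays_mono[OF a] by simp
  qed
  then show ?thesis using x0 by (simp add: core_def)
qed

lemma core_subset_unstable: "core \<subseteq> unstable"
  by (auto simp: core_def)

lemma compact_core: "compact core"
  unfolding compact_eq_seq_compact_metric seq_compact_def
proof (intro allI impI)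
  fix x :: "nat \<Rightarrow> 'x" assume x: "\<forall>k. x k \<in> core"
  then obtain l r where r: "l \<in> unstable" "strict_mono r" "(x \<circ> r) \<longlonglongrightarrow> l"
    using compact_unstable core_subset_unstable
    unfolding compact_eq_seq_compact_metric seq_compact_def by (metis subsetD)
  have "l \<in> core"
    by (rule core_limit[OF index_sequence_zero r(3,1), where s = "\<lambda>_. 0"])
       (use x in \<open>auto simp: stays_index_zero core_def\<close>)
  then show "\<exists>l\<in>core. \<exists>r. strict_mono r \<and> (x \<circ> r) \<longlonglongrightarrow> l" using r by blast
qed

lemma core_subset_max_inv: "core \<subseteq> max_inv \<pi>0 Nt"
proof
  fix x assume x: "x \<in> core"
  then have xu: "x \<in> unstable" using core_subset_unstable by blast
  have "\<exists>y. \<forall>m. (y m \<in> unstable \<and> (m = 0 \<longrightarrow> y m = x)) \<and>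
      (stays \<pi>0 (y (Suc m)) 1 Nt \<and> run \<pi>0 (y (Suc m)) 1 = y m)"
  proof (rule dependent_nat_choice)
    show "\<exists>y. y \<in> unstable \<and> (0 = (0::nat) \<longrightarrow> y = x)" using xu by blast
    show "\<exists>v. (v \<in> unstable \<and> (Suc m = 0 \<longrightarrow> v = x)) \<and> stays \<pi>0 v 1 Nt \<and> run \<pi>0 v 1 = u"
      if "u \<in> unstable \<and> (m = 0 \<longrightarrow> u = x)" for u m
      using unstable_step_back[of u] that by blast
  qed
  then obtain y where y: "y 0 = x"
    "\<And>m. stays \<pi>0 (y (Suc m)) 1 Nt \<and> run \<pi>0 (y (Suc m)) 1 = y m" by metis
  show "x \<in> max_inv \<pi>0 Nt"
    by (rule max_inv_from_backward_chain[OF law0 no_blowup0 _ y])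
       (use x stays_run lifeD in \<open>fastforce simp: core_def\<close>)
qed

end

section \<open>Uniform estimates for the family\<close>

text \<open>The indices of the flows in question: all large ones and that of the limit flow.\<close>

definition in_tail :: "nat \<Rightarrow> nat \<Rightarrow> bool" where
  "in_tail k n \<longleftrightarrow> n = 0 \<or> k \<le> n"

lemma in_tail_mono: "in_tail k n \<Longrightarrow> j \<le> k \<Longrightarrow> in_tail j n"
  by (auto simp: in_tail_def)

text \<open>The common skeleton of the uniform estimates below. If an estimate fails for every \<open>k\<close>,
  then there are violations with indices from an index sequence at points that converge to a point
  of \<open>A\<close>.\<close>

lemma tail_near_compact:
  fixes A :: "'a::metric_space set"
  assumes A: "compact A"
    and ex: "\<And>k. \<exists>n s x. in_tail k n \<and> x \<in> near A k \<and> Q k n s x"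
  obtains n s x a r where "index_sequence n" "a \<in> A" "x \<longlonglongrightarrow> a" "strict_mono r"
    "\<And>k. Q (r k) (n k) (s k) (x k)"
proof -
  obtain n s x where h: "\<And>k. in_tail k (n k)" "\<And>k. x k \<in> near A k" "\<And>k. Q k (n k) (s k) (x k)"
    using ex by metis
  obtain r where r: "strict_mono r" "index_sequence (n \<circ> r)"
    using index_sequence_extract h(1) unfolding in_tail_def by blast
  have "(x \<circ> r) k \<in> near A k" for k
    using h(2)[of "r k"] near_antimono[OF seq_suble[OF r(1), of k]] by auto
  then obtain q a where q: "strict_mono q" "a \<in> A" "((x \<circ> r) \<circ> q) \<longlonglongrightarrow> a"
    using near_compact_subseq[OF A] by blast
  show ?thesis
    by (rule that[of "(n \<circ> r) \<circ> q" a "(x \<circ> r) \<circ> q" "r \<circ> q" "(s \<circ> r) \<circ> q"])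
       (use index_sequence_subseq[OF r(2) q(1)] q strict_mono_o[OF r(1) q(1)] h(3) in auto)
qed

context semi_singular_limit
begin

text \<open>Otherwise orbits in \<open>Nt\<close> that start ever closer to the unstable set would end away from it,
  contrary to \<open>unstable_attracts\<close>. The bound \<open>j < k\<close> serves to build strictly decreasing chains.\<close>

lemma unstable_absorbs:
  "\<exists>k>j. \<forall>n s x t. in_tail k n \<longrightarrow> x \<in> near unstable k \<longrightarrow> 0 \<le> t \<longrightarrow>
     stays (\<phi> n) (s, x) t (UNIV \<times> Nt) \<longrightarrow> snd (run (\<phi> n) (s, x) t) \<in> near unstable j"
proof (rule ccontr)
  define Q where "Q n s x \<longleftrightarrow> (\<exists>t. 0 \<le> t \<and> stays (\<phi> n) (s, x) t (UNIV \<times> Nt) \<and>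
      snd (run (\<phi> n) (s, x) t) \<notin> near unstable j)" for n s x
  assume "\<not> ?thesis"
  then have neg: "\<exists>n s x. in_tail k n \<and> x \<in> near unstable k \<and> Q n s x" if "j < k" for k
    using that unfolding Q_def by blast
  have "\<exists>n s x. in_tail k n \<and> x \<in> near unstable k \<and> Q n s x" for k
  proof -
    obtain n s x where "in_tail (max k (Suc j)) n" "x \<in> near unstable (max k (Suc j))" "Q n s x"
      using neg[of "max k (Suc j)"] max.strict_coboundedI2[of j "Suc j" k] by blast
    then show ?thesis using in_tail_mono[of _ n k] near_antimono[of k "max k (Suc j)" unstable]
      by (metis max.cobounded1 subsetD)
  qed
  from tail_near_compact[OF compact_unstable, of "\<lambda>_. Q", OF this]
  obtain n s x a where n: "index_sequence n" and a: "a \<in> unstable" and x: "x \<longlonglongrightarrow> a"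
    and Q: "\<And>k. Q (n k) (s k) (x k)" by metis
  obtain t where t: "\<And>k. 0 \<le> t k \<and> stays (\<phi> (n k)) (s k, x k) (t k) (UNIV \<times> Nt)"
    "\<And>k. snd (run (\<phi> (n k)) (s k, x k) (t k)) \<notin> near unstable j"
    using Q unfolding Q_def by metis
  obtain r l where r: "l \<in> unstable"
    "(\<lambda>k. snd (run (\<phi> (n (r k))) (s (r k), x (r k)) (t (r k)))) \<longlonglongrightarrow> l"
    using unstable_attracts[OF n x a t(1)] by blast
  have "l \<in> interior (near unstable j)"
    using r(1) near_interior[of j "Suc j" unstable] unfolding near_def by fastforce
  then have "\<forall>\<^sub>F k in sequentially. snd (run (\<phi> (n (r k))) (s (r k), x (r k)) (t (r k))) \<in> interior (near unstable j)"
    using topological_tendstoD[OF r(2)] by simp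
  then show False
    using eventually_happens'[OF sequentially_bot] t(2) interior_subset by blast
qed

lemma core_nearby_stays:
  assumes U: "open U" "core \<subseteq> U"
  shows "\<exists>k. \<forall>n s x. in_tail k n \<longrightarrow> x \<in> near core k \<longrightarrow> stays (\<phi> n) (s, x) T (UNIV \<times> U)"
proof (rule ccontr)
  assume "\<not> ?thesis"
  then have "\<exists>n s x. in_tail k n \<and> x \<in> near core k \<and> \<not> stays (\<phi> n) (s, x) T (UNIV \<times> U)" for k
    by blast
  from tail_near_compact[OF compact_core, of "\<lambda>_ n s x. \<not> stays (\<phi> n) (s, x) T (UNIV \<times> U)", OF this]
  obtain n s x a where n: "index_sequence n" and a: "a \<in> core" and x: "x \<longlonglongrightarrow> a"
    and ns: "\<And>k. \<not> stays (\<phi> (n k)) (s k, x k) T (UNIV \<times> U)" by metis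
  show False using stays_nearby[OF n x core_stays[OF a U(2)] U(1)] ns by blast
qed

text \<open>A point of the unstable set has an infinite past in \<open>Nt\<close>. Hence points near this set that
  have a long future in \<open>Nt\<close> under some flow of large index can only accumulate at the core.\<close>

lemma long_stay_near_core:
  "\<exists>k. \<forall>n s x. in_tail k n \<longrightarrow> x \<in> near unstable k \<longrightarrow>
     stays (\<phi> n) (s, x) (real k) (UNIV \<times> Nt) \<longrightarrow> x \<in> near core j"
proof (rule ccontr)
  define Q where "Q k n s x \<longleftrightarrow> stays (\<phi> n) (s, x) (real k) (UNIV \<times> Nt) \<and> x \<notin> near core j" for k n s x
  assume "\<not> ?thesis"
  then have "\<exists>n s x. in_tail k n \<and> x \<in> near unstable k \<and> Q k n s x" for k
    unfolding Q_def by blast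
  from tail_near_compact[OF compact_unstable, of Q, OF this]
  obtain n s x a r where n: "index_sequence n" and a: "a \<in> unstable" and x: "x \<longlonglongrightarrow> a"
    and r: "strict_mono r" and Q: "\<And>k. Q (r k) (n k) (s k) (x k)" by metis
  have "a \<in> core"
  proof (rule core_limit[OF n x a])
    show "stays (\<phi> (n k)) (s k, x k) (real k) (UNIV \<times> Nt)" for k
    proof (rule stays_mono)
      show "stays (\<phi> (n k)) (s k, x k) (real (r k)) (UNIV \<times> Nt)"
        using Q[of k] unfolding Q_def by blast
    qed (use seq_suble[OF r] in auto)
  qed
  then have "a \<in> interior (near core j)"
    using near_interior[of j "Suc j" core] unfolding near_def by fastforce
  then have "\<forall>\<^sub>F k in sequentially. x k \<in> interior (near core j)"
    using topological_tendstoD[OF x] by simp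
  then obtain k where "x k \<in> near core j"
    using eventually_happens'[OF sequentially_bot] interior_subset by blast
  then show False using Q unfolding Q_def by blast
qed

lemma max_inv_near_core:
  "\<exists>k. \<forall>n. in_tail k n \<longrightarrow> max_inv (\<phi> n) (UNIV \<times> Nt) \<subseteq> UNIV \<times> near core j"
proof (rule ccontr)
  assume "\<not> ?thesis"
  then have "\<forall>k. \<exists>n z. in_tail k n \<and> z \<in> max_inv (\<phi> n) (UNIV \<times> Nt) \<and> snd z \<notin> near core j"
    by (fastforce simp: mem_Times_iff)
  then obtain n z where h: "\<And>k. in_tail k (n k)" "\<And>k. z k \<in> max_inv (\<phi> (n k)) (UNIV \<times> Nt)"
    "\<And>k. snd (z k) \<notin> near core j" by metis
  obtain r where r: "strict_mono r" "index_sequence (n \<circ> r)"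
    using index_sequence_extract h(1) unfolding in_tail_def by blast
  have "\<exists>w. stays (\<phi> (n k)) w (real k) (UNIV \<times> Nt) \<and> run (\<phi> (n k)) w (real k) = z k" for k
    using max_inv_past[OF law no_blowup h(2), of "real k"] by (metis of_nat_0_le_iff)
  then obtain w where w: "\<And>k. stays (\<phi> (n k)) (w k) (real k) (UNIV \<times> Nt)"
    "\<And>k. run (\<phi> (n k)) (w k) (real k) = z k" by metis
  obtain q l where q: "strict_mono q" "l \<in> unstable"
    "(\<lambda>k. snd (run (\<phi> ((n \<circ> r) (q k))) ((w \<circ> r) (q k)) (real (r (q k))))) \<longlonglongrightarrow> l"
    using unstable_subseq[OF r(2), of "\<lambda>k. real (r k)" "w \<circ> r"] w(1) seq_suble[OF r(1)] by auto
  then have lim: "(\<lambda>k. snd (z (r (q k)))) \<longlonglongrightarrow> l" by (simp add: w(2))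
  have "l \<in> core"
    by (rule core_limit[OF index_sequence_subseq[OF r(2) q(1)] lim q(2), where s = "\<lambda>k. fst (z (r (q k)))"])
       (use max_inv_stays[OF law no_blowup h(2)] in auto)
  then have "l \<in> interior (near core j)"
    using near_interior[of j "Suc j" core] unfolding near_def by fastforce
  then have "\<forall>\<^sub>F k in sequentially. snd (z (r (q k))) \<in> interior (near core j)"
    using topological_tendstoD[OF lim] by simp
  then show False
    using eventually_happens'[OF sequentially_bot] h(3) interior_subset by blast
qed

end

section \<open>Confined blocks and their exit sets\<close>

text \<open>The room between \<open>B\<close> and \<open>Nt\<close> is used to define positively invariant sets by an open
  condition in \<open>Nt\<close>, which makes them closed.\<close>

locale semi_singular_isolation = semi_singular_limit \<pi>0 \<phi> Nt
  for \<pi>0 :: "'x::metric_space pflow" and \<phi> Nt +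
  fixes B :: "'x set"
  assumes closed_B: "closed B" and core_B: "core \<subseteq> interior B" and B_Nt: "B \<subseteq> interior Nt"
begin

lemma B_subset_Nt: "B \<subseteq> Nt"
  using B_Nt interior_subset by blast

text \<open>Near the unstable set, staying in \<open>B\<close> for time \<open>S\<close> under one of the flows forces staying in
  the interior of \<open>B\<close> for time \<open>T\<close> under all of them. This is the only comparison between different
  flows; it holds because a long stay brings the point close to the core, where all flows of large
  index stay in the interior of \<open>B\<close> for any prescribed time.\<close>

definition forces_stay :: "nat \<Rightarrow> real \<Rightarrow> real \<Rightarrow> bool" where
  "forces_stay k T S \<longleftrightarrow> T < S \<and> (\<forall>m n s s' x. in_tail k m \<longrightarrow> in_tail k n \<longrightarrow> x \<in> near unstable k \<longrightarrow>
     stays (\<phi> n) (s, x) S (UNIV \<times> B) \<longrightarrow> stays (\<phi> m) (s', x) T (UNIV \<times> interior B))"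

lemma forces_stay_mono: "forces_stay j T S \<Longrightarrow> j \<le> k \<Longrightarrow> forces_stay k T S"
  unfolding forces_stay_def using in_tail_mono near_antimono subsetD by meson

lemma forces_stay_exists: "\<exists>k S. forces_stay k T S"
proof -
  obtain j where j: "\<And>n s x. in_tail j n \<Longrightarrow> x \<in> near core j \<Longrightarrow> stays (\<phi> n) (s, x) T (UNIV \<times> interior B)"
    using core_nearby_stays[OF open_interior core_B, of T] by blast
  obtain k where k: "\<And>n s x. in_tail k n \<Longrightarrow> x \<in> near unstable k \<Longrightarrow>
     stays (\<phi> n) (s, x) (real k) (UNIV \<times> Nt) \<Longrightarrow> x \<in> near core j"
    using long_stay_near_core by blast
  have "forces_stay (max j k) T (max (real k) (T + 1))"
    unfolding forces_stay_def
  proof (intro conjI allI impI)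
    fix m n s s' x
    assume m: "in_tail (max j k) m" and n: "in_tail (max j k) n" and x: "x \<in> near unstable (max j k)"
      and st: "stays (\<phi> n) (s, x) (max (real k) (T + 1)) (UNIV \<times> B)"
    have "stays (\<phi> n) (s, x) (real k) (UNIV \<times> Nt)"
      by (rule stays_mono[OF st]) (use B_subset_Nt in auto)
    moreover have "x \<in> near unstable k" using x near_antimono[of k "max j k"] by auto
    ultimately have "x \<in> near core j" using k[of n x s] in_tail_mono[OF n, of k] by simp
    then show "stays (\<phi> m) (s', x) T (UNIV \<times> interior B)" using j[of m x s'] in_tail_mono[OF m, of j] by simp
  qed simp
  then show ?thesis by blast
qed

lemma forces_stay_chain: "\<exists>\<tau> k. \<tau> 0 = 0 \<and> (\<forall>i<m. forces_stay k (\<tau> i) (\<tau> (Suc i)))"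
proof (induction m)
  case (Suc m)
  then obtain \<tau> k where t: "\<tau> 0 = 0" "\<And>i. i < m \<Longrightarrow> forces_stay k (\<tau> i) (\<tau> (Suc i))" by blast
  obtain j S where S: "forces_stay j (\<tau> m) S" using forces_stay_exists by blast
  let ?\<tau> = "\<tau>(Suc m := S)"
  have "forces_stay (max j k) (?\<tau> i) (?\<tau> (Suc i))" if "i < Suc m" for i
    using that t(2)[of i] S by (cases "i = m") (auto intro: forces_stay_mono)
  then show ?case using t(1) by (intro exI[of _ ?\<tau>] exI[of _ "max j k"]) auto
qed auto

definition absorbs :: "nat \<Rightarrow> nat \<Rightarrow> bool" where
  "absorbs j k \<longleftrightarrow> j < k \<and> (\<forall>n s x t. in_tail k n \<longrightarrow> x \<in> near unstable k \<longrightarrow> 0 \<le> t \<longrightarrow>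
     stays (\<phi> n) (s, x) t (UNIV \<times> Nt) \<longrightarrow> snd (run (\<phi> n) (s, x) t) \<in> near unstable j)"

lemma absorbs_chain: "\<exists>\<kappa>. \<kappa> 0 = j \<and> (\<forall>i. absorbs (\<kappa> i) (\<kappa> (Suc i)))"
proof -
  have "\<exists>k. absorbs i k" for i
    using unstable_absorbs[of i] unfolding absorbs_def by blast
  then obtain f where f: "\<And>i. absorbs i (f i)" by metis
  then show ?thesis by (intro exI[of _ "\<lambda>i. (f ^^ i) j"]) simp
qed

text \<open>Points of \<open>B\<close> whose orbits remain near the unstable set while they are in the interior of
  \<open>Nt\<close>. Such a set is positively invariant relative to \<open>B\<close>, and because staying in the interior is an
  open condition on the initial point, it is also closed for the limit flow. The closure of a
  positively invariant set of reachable points need not be positively invariant.\<close>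

definition confined :: "nat \<Rightarrow> nat \<Rightarrow> (real \<times> 'x) set" where
  "confined n j = {z. snd z \<in> B \<and> (\<forall>t\<ge>0. stays (\<phi> n) z t (UNIV \<times> interior Nt) \<longrightarrow>
     snd (run (\<phi> n) z t) \<in> near unstable j)}"

definition block :: "nat \<Rightarrow> nat \<Rightarrow> real \<Rightarrow> (real \<times> 'x) set" where
  "block n j T = confined n j \<inter> {z. stays (\<phi> n) z T (UNIV \<times> B)}"

definition exit_part :: "nat \<Rightarrow> nat \<Rightarrow> real \<Rightarrow> real \<Rightarrow> (real \<times> 'x) set" where
  "exit_part n j T T' = block n j T - {z. stays (\<phi> n) z T' (UNIV \<times> B)}"

lemma confined_near: "z \<in> confined n j \<Longrightarrow> snd z \<in> near unstable j"
  unfolding confined_def using B_Nt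
  by (auto simp: stays_zero[OF law] run_zero[OF law] mem_Times_iff dest!: spec[of _ 0])

lemma confined_if_near:
  assumes "absorbs j k" "in_tail k n" "x \<in> near unstable k" "x \<in> B"
  shows "(s, x) \<in> confined n j"
  unfolding confined_def
proof (intro CollectI conjI allI impI)
  fix t :: real assume t: "0 \<le> t" and st: "stays (\<phi> n) (s, x) t (UNIV \<times> interior Nt)"
  have "stays (\<phi> n) (s, x) t (UNIV \<times> Nt)"
    by (rule stays_mono[OF st order_refl]) (use interior_subset in auto)
  then show "snd (run (\<phi> n) (s, x) t) \<in> near unstable j"
    using assms(1-3) t unfolding absorbs_def by blast
qed (use assms in simp)

lemma confined_forward:
  assumes z: "z \<in> confined n j" and t: "0 \<le> t" and st: "stays (\<phi> n) z t (UNIV \<times> B)"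
  shows "run (\<phi> n) z t \<in> confined n j"
  unfolding confined_def
proof (intro CollectI conjI allI impI)
  show "snd (run (\<phi> n) z t) \<in> B" using stays_run[OF st t] by auto
  fix r :: real assume r: "0 \<le> r" and s: "stays (\<phi> n) (run (\<phi> n) z t) r (UNIV \<times> interior Nt)"
  have "UNIV \<times> B \<subseteq> UNIV \<times> interior Nt" using B_Nt by blast
  then have "stays (\<phi> n) z t (UNIV \<times> interior Nt)" by (rule stays_mono[OF st order_refl])
  then have a: "stays (\<phi> n) z (t + r) (UNIV \<times> interior Nt)" by (rule stays_append[OF law _ s t])
  then have "snd (run (\<phi> n) z (t + r)) \<in> near unstable j"
    using z t r unfolding confined_def by simp
  then show "snd (run (\<phi> n) (run (\<phi> n) z t) r) \<in> near unstable j"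
    using stays_run_add[OF law a t r] by simp
qed

text \<open>Nesting of the blocks of different flows: the outer block has the larger neighbourhood of the
  unstable set and the shorter prescribed stay.\<close>

lemma block_subset:
  assumes "absorbs j j'" "forces_stay k T T'" "k \<le> j'" "in_tail j' m" "in_tail j' n"
  shows "block n j' T' \<subseteq> block m j T"
proof
  fix z assume z: "z \<in> block n j' T'"
  obtain s x where sx: "z = (s, x)" by (cases z)
  have x: "x \<in> near unstable j'" "x \<in> B"
    using z confined_near[of z n j'] by (auto simp: sx block_def confined_def)
  have "stays (\<phi> m) (s, x) T (UNIV \<times> interior B)"
    using assms in_tail_mono[OF assms(4) assms(3)] in_tail_mono[OF assms(5) assms(3)] near_antimono[OF assms(3)] x z
    unfolding forces_stay_def block_def sx by blast
  then have "stays (\<phi> m) (s, x) T (UNIV \<times> B)"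
    by (rule stays_mono) (use interior_subset in auto)
  then show "z \<in> block m j T"
    using confined_if_near[OF assms(1,4) x] by (simp add: block_def sx)
qed

text \<open>For the exit sets the second time has to be ordered the other way: a point that leaves \<open>B\<close>
  under one flow before time \<open>S'\<close> leaves it under the other before the larger time \<open>S\<close>.\<close>

lemma exit_part_subset:
  assumes "absorbs j j'" "forces_stay k T T'" "forces_stay k S' S" "k \<le> j'" "in_tail j' m" "in_tail j' n"
  shows "exit_part n j' T' S' \<subseteq> exit_part m j T S"
proof
  fix z assume z: "z \<in> exit_part n j' T' S'"
  obtain s x where sx: "z = (s, x)" by (cases z)
  have x: "x \<in> near unstable k"
    using z confined_near[of z n j'] near_antimono[OF assms(4)] by (auto simp: sx block_def exit_part_def)
  have "\<not> stays (\<phi> m) z S (UNIV \<times> B)"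
  proof
    assume "stays (\<phi> m) z S (UNIV \<times> B)"
    then have "stays (\<phi> n) z S' (UNIV \<times> interior B)"
      using assms(3) in_tail_mono[OF assms(5,4)] in_tail_mono[OF assms(6,4)] x
      unfolding forces_stay_def sx by blast
    then have "stays (\<phi> n) z S' (UNIV \<times> B)"
      by (rule stays_mono) (use interior_subset in auto)
    then show False using z by (simp add: exit_part_def)
  qed
  then show "z \<in> exit_part m j T S"
    using z block_subset[OF assms(1,2,4,5,6)] by (auto simp: exit_part_def)
qed

lemma block_zero_product: "block 0 j T = UNIV \<times> {x. (0, x) \<in> block 0 j T}"
proof -
  have "(s, x) \<in> block 0 j T \<longleftrightarrow> (0, x) \<in> block 0 j T" for s x
  proof -
    have "snd (run (\<phi> 0) (s, x) t) = snd (run (\<phi> 0) (0, x) t)"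
      if "stays \<pi>0 x t (interior Nt)" "0 \<le> t" for t
      using stays_life[OF that(1,2)] by (simp add: run_index_zero)
    then show ?thesis unfolding block_def confined_def by (auto simp: stays_index_zero)
  qed
  then show ?thesis by auto
qed

text \<open>If the limit orbit is outside the closed neighbourhood at time \<open>t\<close> although it has stayed in the
  interior of \<open>Nt\<close>, then so do the orbits of nearby points, which contradicts their confinement.\<close>

lemma closed_block_zero:
  assumes "0 \<le> T"
  shows "closed {x. (0, x) \<in> block 0 j T}"
  unfolding closed_sequential_limits
proof (intro allI impI, elim conjE)
  fix x l assume x: "\<forall>k. x k \<in> {x. (0, x) \<in> block 0 j T}" and l: "x \<longlonglongrightarrow> l"
  note z = index_sequence_zero
  have "l \<in> B" by (rule closed_sequentially[OF closed_B _ l]) (use x in \<open>auto simp: block_def confined_def\<close>)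
  moreover have "stays \<pi>0 l T B"
    by (rule stays_limit[OF z l tendsto_const, where s = "\<lambda>_. 0"])
       (use x assms closed_B B_subset_Nt in \<open>auto simp: block_def\<close>)
  moreover have "run \<pi>0 l t \<in> near unstable j" if t: "0 \<le> t" "stays \<pi>0 l t (interior Nt)" for t
  proof (rule ccontr)
    assume out: "run \<pi>0 l t \<notin> near unstable j"
    have "(\<lambda>k. snd (run (\<phi> 0) (0, x k) t)) \<longlonglongrightarrow> run \<pi>0 l t"
      using converges[OF z _ l tendsto_const stays_life[OF t(2,1)], where s = "\<lambda>_. 0"] t by simp
    then have "\<forall>\<^sub>F k in sequentially. snd (run (\<phi> 0) (0, x k) t) \<in> - near unstable j"
      using closed_near[OF compact_unstable] out
      by (intro topological_tendstoD) (auto intro: open_Compl)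
    then obtain K where K: "\<And>k. k \<ge> K \<Longrightarrow> snd (run (\<phi> 0) (0, x k) t) \<notin> near unstable j"
      unfolding eventually_sequentially by auto
    obtain k where "stays (\<phi> 0) (0, x (k + K)) t (UNIV \<times> interior Nt)"
      using stays_nearby[OF z LIMSEQ_ignore_initial_segment[OF l, of K] t(2) open_interior, of "\<lambda>_. 0"]
      by blast
    then show False using K[of "k + K"] x t by (auto simp: block_def confined_def)
  qed
  ultimately show "l \<in> {x. (0, x) \<in> block 0 j T}"
    by (auto simp: block_def confined_def stays_index_zero run_index_zero stays_life)
qed

text \<open>A prescribed positive stay in \<open>B\<close> pushes the points of the inner block into the interior of
  \<open>B\<close>, and the intermediate neighbourhood provides room with respect to confinement.\<close>

lemma block_zero_interior:
  assumes a: "absorbs j j'" "j' < j''" and l: "forces_stay k 0 T" and k: "k \<le> j''"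
  shows "{x. (0, x) \<in> block 0 j'' T} \<subseteq> interior {x. (0, x) \<in> block 0 j 0}"
proof
  fix x assume x: "x \<in> {x. (0, x) \<in> block 0 j'' T}"
  have t: "in_tail i 0" for i by (simp add: in_tail_def)
  let ?O = "interior B \<inter> interior (near unstable j')"
  have xn: "x \<in> near unstable j''" using x confined_near[of "(0, x)" 0 j''] by (simp add: block_def)
  have "stays (\<phi> 0) (0, x) 0 (UNIV \<times> interior B)"
    using l x xn t near_antimono[OF k] unfolding forces_stay_def block_def by blast
  then have "x \<in> interior B" by (simp add: stays_zero[OF law])
  moreover have "x \<in> interior (near unstable j')" using xn near_interior[OF a(2)] by blast
  moreover have "?O \<subseteq> {x. (0, x) \<in> block 0 j 0}"
  proof
    fix y assume "y \<in> ?O"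
    then have y: "y \<in> B" "y \<in> near unstable j'" using interior_subset by blast+
    then show "y \<in> {x. (0, x) \<in> block 0 j 0}"
      using confined_if_near[OF a(1) t y(2,1), of 0] by (simp add: block_def stays_zero[OF law])
  qed
  ultimately show "x \<in> interior {x. (0, x) \<in> block 0 j 0}"
    using interior_maximal[of ?O] by blast
qed

lemma block_index_pair:
  assumes T: "0 \<le> T" "T < T'" and M: "block n j T \<subseteq> UNIV \<times> N" "N \<subseteq> Nt" "closed N"
    and G: "open G" "max_inv (\<phi> n) (UNIV \<times> Nt) \<subseteq> G" "G \<subseteq> confined n j"
      "\<And>z. z \<in> G \<Longrightarrow> stays (\<phi> n) z T' (UNIV \<times> B)"
  shows "index_pair (\<phi> n) (UNIV \<times> N) (block n j T) (exit_part n j T T')"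
proof -
  have GN: "G \<subseteq> block n j T - exit_part n j T T'"
    using G(3,4) stays_mono[OF G(4), of _ T "UNIV \<times> B"] T by (auto simp: block_def exit_part_def)
  show ?thesis
  proof (rule index_pair_of_exit_times[OF law no_blowup T block_def exit_part_def])
    show "run (\<phi> n) z t \<in> confined n j" if "z \<in> confined n j" "0 \<le> t" "stays (\<phi> n) z t (UNIV \<times> B)" for z t
      using confined_forward that .
    have "max_inv (\<phi> n) (UNIV \<times> N) = max_inv (\<phi> n) (UNIV \<times> Nt)"
      by (rule max_inv_sandwich[OF law no_blowup]) (use G GN M in auto)
    moreover have "G \<subseteq> interior (UNIV \<times> N)"
      by (rule interior_maximal) (use GN M G(1) in auto)
    ultimately show "isolating_neighborhood (\<phi> n) (UNIV \<times> N)"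
      unfolding isolating_neighborhood_def using G(2) M(3) closed_Times[OF closed_UNIV M(3)] by auto
    show "UNIV \<times> N \<subseteq> UNIV \<times> Nt" "UNIV \<times> B \<subseteq> (UNIV :: real set) \<times> Nt" using M B_subset_Nt by auto
  qed (use M G GN in auto)
qed

end

section \<open>Nesting\<close>

context semi_singular_isolation
begin

text \<open>Levels \<open>1, 2, 3, 4\<close> carry the sets \<open>N\<^sub>0\<close>, \<open>N\<^sub>n\<close>, \<open>N'\<^sub>0\<close>, \<open>N'\<^sub>n\<close>. Level \<open>i\<close> uses the neighbourhood \<open>\<kappa> i\<close>,
  the stay \<open>\<tau> (i - 1)\<close> for the block and the stay \<open>\<tau> (8 - i)\<close> for the exit set, so the two chains of
  inclusions use the two halves of one increasing chain \<open>\<tau> 0 < \<dots> < \<tau> 7\<close>. The times have to be chosen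
  before the neighbourhoods, for the comparison of stays is valid only near the unstable set, and
  the range of indices is fixed last. The inclusion of \<open>N'\<close> in the interior of \<open>N\<close> carries over to
  products with any first factor, whence the type \<open>'c\<close>.\<close>

lemma nested_index_pairs:
  "\<exists>n0\<ge>1. \<exists>N N'. closed N \<and> closed N' \<and>
    (\<exists>Ns Ls Ns' Ls' :: nat \<Rightarrow> (real \<times> 'x) set.
       Ns' 0 = UNIV \<times> N' \<and> Ns 0 = UNIV \<times> N \<and>
       (\<forall>n \<in> {n. n \<ge> n0} \<union> {0}.
          max_inv (\<phi> n) (UNIV \<times> Nt) \<subseteq> UNIV \<times> N' \<and>
          (UNIV :: 'c::topological_space set) \<times> N' \<subseteq> interior (UNIV \<times> N) \<and>
          interior ((UNIV :: real set) \<times> N) \<subseteq> interior (UNIV \<times> Nt) \<and>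
          index_pair (\<phi> n) (Ns' 0) (Ns' n) (Ls' n) \<and>
          index_pair (\<phi> n) (Ns 0) (Ns n) (Ls n) \<and>
          Ns' n \<subseteq> Ns' 0 \<and> Ns' 0 \<subseteq> Ns n \<and> Ns n \<subseteq> Ns 0 \<and>
          Ls' n \<subseteq> Ls' 0 \<and> Ls' 0 \<subseteq> Ls n \<and> Ls n \<subseteq> Ls 0))"
proof -
  \<comment> \<open>With \<open>\<tau> 0 = 0\<close> the block of level \<open>1\<close> contains all points of \<open>B\<close> sufficiently near the unstable
    set, so that the inner blocks lie in its interior.\<close>
  obtain \<tau> k1 where \<tau>0: "\<tau> 0 = 0" and \<tau>: "\<And>i. i < 7 \<Longrightarrow> forces_stay k1 (\<tau> i) (\<tau> (Suc i))"
    using forces_stay_chain by blast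
  obtain k2 where k2: "\<And>n s x. in_tail k2 n \<Longrightarrow> x \<in> near core k2 \<Longrightarrow>
      stays (\<phi> n) (s, x) (\<tau> 7) (UNIV \<times> interior B)"
    using core_nearby_stays[OF open_interior core_B, of "\<tau> 7"] by blast
  obtain \<kappa> where \<kappa>0: "\<kappa> 0 = max k1 k2" and \<kappa>: "\<And>i. absorbs (\<kappa> i) (\<kappa> (Suc i))"
    using absorbs_chain by blast
  have mono: "strict_mono \<kappa>"
    using \<kappa> by (auto simp: absorbs_def intro: strict_monoI_Suc)
  have \<kappa>_ge: "k1 \<le> \<kappa> i" "k2 \<le> \<kappa> i" for i
    using strict_mono_less_eq[OF mono, of 0 i] \<kappa>0 by auto
  obtain k3 where k3: "\<And>n. in_tail k3 n \<Longrightarrow> max_inv (\<phi> n) (UNIV \<times> Nt) \<subseteq> UNIV \<times> near core (Suc (\<kappa> 5))"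
    using max_inv_near_core by blast
  define K where "K = max k3 (\<kappa> 5)"
  have K: "in_tail (\<kappa> i) n" "in_tail k3 n" if "in_tail K n" "i \<le> 5" for n i
    using in_tail_mono[OF that(1)] strict_mono_less_eq[OF mono, of i 5] that(2) by (auto simp: K_def)
  have zero: "in_tail K 0" by (simp add: in_tail_def)

  have \<tau>_less: "\<tau> 0 < \<tau> 1" "\<tau> 1 < \<tau> 2" "\<tau> 2 < \<tau> 3" "\<tau> 3 < \<tau> 4" "\<tau> 4 < \<tau> 5" "\<tau> 5 < \<tau> 6" "\<tau> 6 < \<tau> 7"
    using \<tau>[of 0] \<tau>[of 1] \<tau>[of 2] \<tau>[of 3] \<tau>[of 4] \<tau>[of 5] \<tau>[of 6]
    by (simp_all add: forces_stay_def numeral_eq_Suc)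

  define Nl where "Nl i n = block n (\<kappa> i) (\<tau> (i - 1))" for i n
  define Ll where "Ll i n = exit_part n (\<kappa> i) (\<tau> (i - 1)) (\<tau> (8 - i))" for i n
  have Nl_sub: "Nl (Suc i) n \<subseteq> Nl i m"
    if "in_tail K m" "in_tail K n" "1 \<le> i" "i \<le> 3" for i m n
    unfolding Nl_def using that \<tau>[of "i - 1"]
    by (intro block_subset[OF \<kappa> _ \<kappa>_ge(1)] K) auto
  have Ll_sub: "Ll (Suc i) n \<subseteq> Ll i m"
    if i: "in_tail K m" "in_tail K n" "1 \<le> i" "i \<le> 3" for i m n
  proof -
    have "8 - i = Suc (8 - Suc i)" using i by simp
    then show ?thesis
      unfolding Ll_def using i \<tau>[of "i - 1"] \<tau>[of "8 - Suc i"]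
      by (intro exit_part_subset[OF \<kappa> _ _ \<kappa>_ge(1)] K) auto
  qed

  define N where "N = {x. (0, x) \<in> Nl 1 0}"
  define N' where "N' = {x. (0, x) \<in> Nl 3 0}"
  have N: "Nl 1 0 = UNIV \<times> N" and N': "Nl 3 0 = UNIV \<times> N'"
    unfolding N_def N'_def Nl_def by (rule block_zero_product)+
  have cl: "closed N" "closed N'"
    unfolding N_def N'_def Nl_def using \<tau>0 \<tau>_less by (auto intro!: closed_block_zero)
  have N_Nt: "N \<subseteq> Nt"
    using B_subset_Nt by (auto simp: N_def Nl_def block_def confined_def)
  have N'_int: "N' \<subseteq> interior N"
  proof -
    have "N' \<subseteq> {x. (0, x) \<in> block 0 (\<kappa> 3) (\<tau> 1)}"
      unfolding N'_def Nl_def block_def using \<tau>_less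
      by (auto intro: stays_mono)
    also have "\<dots> \<subseteq> interior {x. (0, x) \<in> block 0 (\<kappa> 1) 0}"
      by (rule block_zero_interior[OF \<kappa> _ _ \<kappa>_ge(1)])
         (use \<tau>[of 0] \<tau>0 strict_mono_less[OF mono] in auto)
    finally show ?thesis by (simp add: N_def Nl_def \<tau>0)
  qed

  \<comment> \<open>All levels contain the points so close to the core that every flow keeps them in \<open>B\<close> up to
    the longest time \<open>\<tau> 7\<close>; the spare neighbourhood \<open>\<kappa> 5\<close> gives confinement on level \<open>4\<close>.\<close>
  define G where "G = (UNIV :: real set) \<times> interior (near core (\<kappa> 5))"
  have oG: "open G" unfolding G_def by (intro open_Times) auto
  have KG: "max_inv (\<phi> n) (UNIV \<times> Nt) \<subseteq> G" if "in_tail K n" for n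
    using k3[OF K(2)[OF that, of 0]] near_interior[of "\<kappa> 5" "Suc (\<kappa> 5)" core] by (auto simp: G_def)
  have G_stays: "stays (\<phi> n) z T (UNIV \<times> B)" if n: "in_tail K n" and zG: "z \<in> G" and T: "T \<le> \<tau> 7" for n z T
  proof -
    obtain s x where z: "z = (s, x)" "x \<in> near core (\<kappa> 5)"
      using zG interior_subset by (auto simp: G_def)
    then have "stays (\<phi> n) z (\<tau> 7) (UNIV \<times> interior B)"
      using k2[of n x s] near_antimono[OF \<kappa>_ge(2)] in_tail_mono[OF K(1)[OF n, of 5] \<kappa>_ge(2)] by auto
    then show ?thesis by (rule stays_mono) (use T interior_subset in auto)
  qed
  have G_confined: "G \<subseteq> confined n (\<kappa> i)" if n: "in_tail K n" and i: "i \<le> 4" for n i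
  proof
    fix z assume z: "z \<in> G"
    obtain s x where sx: "z = (s, x)" by (cases z)
    have "near core (\<kappa> 5) \<subseteq> near unstable (\<kappa> (Suc i))"
      using near_antimono[of "\<kappa> (Suc i)" "\<kappa> 5" core] strict_mono_less_eq[OF mono, of "Suc i" 5] i
        near_mono[OF core_subset_unstable, of "\<kappa> (Suc i)"] by auto
    then have "x \<in> near unstable (\<kappa> (Suc i))"
      using z interior_subset by (auto simp: G_def sx)
    moreover have "x \<in> B"
      using G_stays[OF n z, of 0] \<tau>_less \<tau>0 by (simp add: stays_zero[OF law] sx)
    ultimately show "z \<in> confined n (\<kappa> i)"
      unfolding sx using i by (intro confined_if_near[OF \<kappa> K(1)[OF n]]) auto
  qed
  have pair: "index_pair (\<phi> n) (UNIV \<times> M) (Nl i n) (Ll i n)"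
    if "in_tail K n" "1 \<le> i" "i \<le> 4" "Nl i n \<subseteq> UNIV \<times> M" "M \<subseteq> Nt" "closed M" for n i M
  proof -
    have "i = 1 \<or> i = 2 \<or> i = 3 \<or> i = 4" using that by auto
    then have t: "0 \<le> \<tau> (i - 1)" "\<tau> (i - 1) < \<tau> (8 - i)" "\<tau> (8 - i) \<le> \<tau> 7"
      using \<tau>0 \<tau>_less by auto
    show ?thesis
      using that(4) unfolding Nl_def Ll_def
      by (rule block_index_pair[OF t(1,2) _ that(5,6) oG KG[OF that(1)] G_confined[OF that(1,3)]])
         (use G_stays[OF that(1)] t(3) in auto)
  qed

  define Ns where "Ns n = (if n = 0 then Nl 1 n else Nl 2 n)" for n
  define Ls where "Ls n = (if n = 0 then Ll 1 n else Ll 2 n)" for n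
  define Ns' where "Ns' n = (if n = 0 then Nl 3 n else Nl 4 n)" for n
  define Ls' where "Ls' n = (if n = 0 then Ll 3 n else Ll 4 n)" for n
  have n1: "Suc 1 = 2" "Suc 2 = 3" "Suc 3 = 4" by auto
  have main: "max_inv (\<phi> n) (UNIV \<times> Nt) \<subseteq> UNIV \<times> N' \<and>
          (UNIV :: 'c::topological_space set) \<times> N' \<subseteq> interior (UNIV \<times> N) \<and>
          interior ((UNIV :: real set) \<times> N) \<subseteq> interior (UNIV \<times> Nt) \<and>
          index_pair (\<phi> n) (Ns' 0) (Ns' n) (Ls' n) \<and>
          index_pair (\<phi> n) (Ns 0) (Ns n) (Ls n) \<and>
          Ns' n \<subseteq> Ns' 0 \<and> Ns' 0 \<subseteq> Ns n \<and> Ns n \<subseteq> Ns 0 \<and>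
          Ls' n \<subseteq> Ls' 0 \<and> Ls' 0 \<subseteq> Ls n \<and> Ls n \<subseteq> Ls 0"
    if "n \<in> {n. n \<ge> max K 1} \<union> {0}" for n
  proof -
    have n: "in_tail K n" using that by (auto simp: in_tail_def)
    note sub = Nl_sub[OF zero n, of 1, unfolded n1] Nl_sub[OF n zero, of 2, unfolded n1] Nl_sub[OF zero n, of 3, unfolded n1]
      Ll_sub[OF zero n, of 1, unfolded n1] Ll_sub[OF n zero, of 2, unfolded n1] Ll_sub[OF zero n, of 3, unfolded n1]
    have s1: "Ns' n \<subseteq> Ns' 0" "Ns n \<subseteq> Ns 0" "Ls' n \<subseteq> Ls' 0" "Ls n \<subseteq> Ls 0"
      using sub by (auto simp: Ns'_def Ns_def Ls'_def Ls_def)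
    have s2: "Ns' 0 \<subseteq> Ns n"
      using sub(1,2) Nl_sub[OF zero zero, of 1, unfolded n1] by (auto simp: Ns'_def Ns_def)
    have s3: "Ls' 0 \<subseteq> Ls n"
      using sub(4,5) Ll_sub[OF zero zero, of 1, unfolded n1] by (auto simp: Ls'_def Ls_def)
    have N'N: "N' \<subseteq> Nt" using N'_int N_Nt interior_subset by blast
    have p1: "index_pair (\<phi> n) (Ns' 0) (Ns' n) (Ls' n)"
      using pair[OF n, of 3 N'] pair[OF n, of 4 N'] s1(1) N'N cl N'
      by (cases "n = 0") (auto simp: Ns'_def Ls'_def)
    have p2: "index_pair (\<phi> n) (Ns 0) (Ns n) (Ls n)"
      using pair[OF n, of 1 N] pair[OF n, of 2 N] s1(2) N_Nt cl N
      by (cases "n = 0") (auto simp: Ns_def Ls_def)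
    have "max_inv (\<phi> n) (UNIV \<times> Nt) \<subseteq> UNIV \<times> N'"
    proof -
      have "G \<subseteq> Nl 3 0"
        unfolding Nl_def block_def using G_confined[OF zero, of 3] G_stays[OF zero] \<tau>_less by auto
      then show ?thesis using KG[OF n] N' by simp
    qed
    moreover have "(UNIV :: 'c set) \<times> N' \<subseteq> interior (UNIV \<times> N)"
      using N'_int by (auto simp: interior_Times)
    moreover have "interior ((UNIV :: real set) \<times> N) \<subseteq> interior (UNIV \<times> Nt)"
      using N_Nt by (intro interior_mono) auto
    ultimately show ?thesis using s1 s2 s3 p1 p2 by blast
  qed
  have zero_level: "Ns' 0 = UNIV \<times> N'" "Ns 0 = UNIV \<times> N"
    using N N' by (simp_all add: Ns'_def Ns_def)
  show ?thesis
    by (rule exI[of _ "max K 1"], rule conjI, simp, rule exI[of _ N], rule exI[of _ N'],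
        rule conjI[OF cl(1)], rule conjI[OF cl(2)], rule exI[of _ Ns], rule exI[of _ Ls],
        rule exI[of _ Ns'], rule exI[of _ Ls'], rule conjI[OF zero_level(1)],
        rule conjI[OF zero_level(2)], rule ballI, rule main)
qed

end

section \<open>The extended family satisfies the hypotheses\<close>

lemma local_semiflow_continuous:
  fixes \<psi> :: "'z::topological_space pflow"
  assumes l: "local_semiflow \<psi>" and t: "\<forall>k. 0 \<le> t k" "t \<longlonglongrightarrow> t0" "t0 \<in> life \<psi> x0" and x: "x \<longlonglongrightarrow> x0"
  shows "(\<forall>\<^sub>F k in sequentially. t k \<in> life \<psi> (x k)) \<and> (\<lambda>k. run \<psi> (x k) (t k)) \<longlonglongrightarrow> run \<psi> x0 t0"
proof -
  note d = dom_iff_life[OF l]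
  have op: "openin (top_of_set ({0..} \<times> UNIV)) (dom \<psi>)"
    and cont: "continuous_on (dom \<psi>) (\<lambda>(t, x). run \<psi> x t)"
    using l unfolding local_semiflow_def by blast+
  obtain T where T: "open T" "dom \<psi> = ({0..} \<times> UNIV) \<inter> T"
    using op unfolding openin_open by blast
  have lim: "(\<lambda>k. (t k, x k)) \<longlonglongrightarrow> (t0, x0)" by (intro tendsto_Pair t x)
  have in0: "(t0, x0) \<in> dom \<psi>" using t by (simp add: d)
  then have "(t0, x0) \<in> T" using T by blast
  then have "\<forall>\<^sub>F k in sequentially. (t k, x k) \<in> T" using topological_tendstoD[OF lim T(1)] by blast
  then have ev: "\<forall>\<^sub>F k in sequentially. (t k, x k) \<in> dom \<psi>"
    by eventually_elim (use t(1) T(2) in auto)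
  have "(\<lambda>k. (\<lambda>(t, x). run \<psi> x t) (t k, x k)) \<longlonglongrightarrow> (\<lambda>(t, x). run \<psi> x t) (t0, x0)"
    by (rule continuous_on_tendsto_compose[OF cont lim in0 ev])
  then show ?thesis using ev by (simp add: d)
qed

lemma dom_time_extension: "(t, (s, x)) \<in> dom (time_extension \<pi>0) \<longleftrightarrow> (t, x) \<in> dom \<pi>0"
  by (auto simp: time_extension_def dom_def)

lemma life_time_extension: "life (time_extension \<pi>0) (s, x) = life \<pi>0 x"
  by (simp add: life_def omega_def dom_time_extension)

lemma run_time_extension:
  assumes "local_semiflow \<pi>0" "t \<in> life \<pi>0 x"
  shows "run (time_extension \<pi>0) (s, x) t = (s + t, run \<pi>0 x t)"
proof -
  have "(t, x) \<in> dom \<pi>0" using assms by (simp add: dom_iff_life)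
  then show ?thesis by (auto simp: run_def time_extension_def)
qed

lemma law_time_extension:
  assumes l: "local_semiflow \<pi>0"
  shows "semiflow_law (time_extension \<pi>0)"
proof -
  note law = local_semiflow_law[OF l]
  note sm = life_time_extension run_time_extension[OF l] zero_in_life[OF law] run_zero[OF law]
    life_add_iff[OF law] run_add[OF law]
  show ?thesis
    unfolding semiflow_law_def
    by (auto simp: sm)
qed

lemma fill_subsequence:
  fixes y :: "nat \<Rightarrow> 'b::topological_space"
  assumes r: "strict_mono r" and y: "y \<longlonglongrightarrow> y0"
  obtains y' where "\<And>k. y' (r k) = y k" "y' \<longlonglongrightarrow> y0" "\<And>m. y' m \<in> insert y0 (range y)"
proof -
  define y' where "y' m = (if m \<in> range r then y (inv r m) else y0)" for m
  have y'_r: "y' (r k) = y k" for k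
    using strict_mono_imp_inj_on[OF r] by (simp add: y'_def)
  have "y' \<longlonglongrightarrow> y0"
  proof (rule topological_tendstoI)
    fix S assume S: "open S" "y0 \<in> S"
    then obtain k0 where k0: "\<And>k. k \<ge> k0 \<Longrightarrow> y k \<in> S"
      using topological_tendstoD[OF y] unfolding eventually_sequentially by blast
    have "y' m \<in> S" if m: "m \<ge> r k0" for m
    proof (cases "m \<in> range r")
      case True
      then obtain k where k: "m = r k" by blast
      then show ?thesis using k0 m strict_mono_less_eq[OF r] by (simp add: y'_r)
    qed (simp add: y'_def S)
    then show "\<forall>\<^sub>F m in sequentially. y' m \<in> S" unfolding eventually_sequentially by blast
  qed
  moreover have "y' m \<in> insert y0 (range y)" for m by (simp add: y'_def)
  ultimately show ?thesis using that y'_r by blast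
qed

text \<open>Convergence along all indices can be applied to data given along a subsequence after filling
  the gaps with the limits.\<close>

lemma semi_singular_convergence_subseq:
  fixes \<pi>0 :: "'x::metric_space pflow"
  assumes c: "semi_singular_convergence \<pi>s \<pi>0" and r: "strict_mono r"
    and t: "\<forall>k. 0 \<le> t k" "t \<longlonglongrightarrow> t0" "ereal t0 < omega \<pi>0 x0" and x: "x \<longlonglongrightarrow> x0"
  shows "(\<forall>\<^sub>F k in sequentially. (t k, (s k, x k)) \<in> dom (\<pi>s (r k))) \<and>
    (\<lambda>k. snd (run (\<pi>s (r k)) (s k, x k) (t k))) \<longlonglongrightarrow> run \<pi>0 x0 t0"
proof -
  obtain x' where x': "\<And>k. x' (r k) = x k" "x' \<longlonglongrightarrow> x0"
    using fill_subsequence[OF r x] by metis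
  obtain t' where t': "\<And>k. t' (r k) = t k" "t' \<longlonglongrightarrow> t0" "\<And>m. t' m \<in> insert t0 (range t)"
    using fill_subsequence[OF r t(2)] by metis
  define s' where "s' m = s (inv r m)" for m
  have s': "s' (r k) = s k" for k
    using strict_mono_imp_inj_on[OF r] by (simp add: s'_def)
  have "0 \<le> t0" by (rule LIMSEQ_le_const[OF t(2)]) (use t(1) in auto)
  then have "0 \<le> t' m" for m using t(1) t'(3)[of m] by auto
  then have "(\<forall>\<^sub>F m in sequentially. (t' m, (s' m, x' m)) \<in> dom (\<pi>s m)) \<and>
      (\<lambda>m. snd (run (\<pi>s m) (s' m, x' m) (t' m))) \<longlonglongrightarrow> run \<pi>0 x0 t0"
    using c[unfolded semi_singular_convergence_def, rule_format, of t' x' x0 t0 s'] x'(2) t'(2) t(3) by blast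
  then show ?thesis
    using eventually_subseq[OF r, of "\<lambda>m. (t' m, (s' m, x' m)) \<in> dom (\<pi>s m)"]
      LIMSEQ_subseq_LIMSEQ[OF _ r, of "\<lambda>m. snd (run (\<pi>s m) (s' m, x' m) (t' m))"]
    by (simp add: o_def x'(1) t'(1) s')
qed

text \<open>Constant index sequences reduce to continuity and admissibility of \<open>\<pi>0\<close>, strictly increasing
  ones to the hypotheses on the approximating flows.\<close>

lemma semi_singular_limit_extended_family:
  fixes \<pi>0 :: "'x::metric_space pflow"
    and \<pi>s :: "nat \<Rightarrow> (real \<times> 'x) pflow"
  assumes l0: "local_semiflow \<pi>0"
    and l: "\<And>n. n \<ge> 1 \<Longrightarrow> local_semiflow (\<pi>s n)"
    and cl: "closed Nt"
    and adm0: "strongly_admissible \<pi>0 Nt"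
    and conv: "semi_singular_convergence \<pi>s \<pi>0"
    and adm: "\<And>r :: nat \<Rightarrow> nat. strict_mono r \<Longrightarrow>
           strongly_semi_singular_admissible (\<lambda>m. \<pi>s (r m)) (UNIV \<times> Nt)"
  shows "semi_singular_limit \<pi>0 (extended_family \<pi>0 \<pi>s) Nt"
proof -
  let ?\<phi> = "extended_family \<pi>0 \<pi>s"
  have ext: "?\<phi> 0 = time_extension \<pi>0" "\<And>n. n \<ge> 1 \<Longrightarrow> ?\<phi> n = \<pi>s n"
    by (auto simp: extended_family_def)
  note life0 = life_time_extension and run0 = run_time_extension[OF l0]
  have g0: "no_blowup_in \<pi>0 Nt"
    using adm0 unfolding strongly_admissible_def no_blowup_in_def life_eq_all_iff by blast
  show ?thesis
  proof
    show "closed Nt" by (fact cl)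
    show "semiflow_law (?\<phi> n)" for n
      using law_time_extension[OF l0] local_semiflow_law[OF l] ext by (cases "n = 0") auto
    show "semiflow_law \<pi>0" by (rule local_semiflow_law[OF l0])
    show "life (?\<phi> 0) (s, x) = life \<pi>0 x" for s x by (simp add: ext life0)
    show "run (?\<phi> 0) (s, x) t = (s + t, run \<pi>0 x t)" if "t \<in> life \<pi>0 x" for s x t
      using run0[OF that] by (simp add: ext)
    show "no_blowup_in \<pi>0 Nt" by (fact g0)
    show "no_blowup_in (?\<phi> n) (UNIV \<times> Nt)" for n
    proof (cases "n = 0")
      case True
      have "life (time_extension \<pi>0) z = {0..}"
        if z: "run (time_extension \<pi>0) z ` life (time_extension \<pi>0) z \<subseteq> UNIV \<times> Nt" for z
      proof -
        obtain s x where sx: "z = (s, x)" by (cases z)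
        have "run \<pi>0 x ` life \<pi>0 x \<subseteq> Nt"
          using z by (auto simp: sx life0 run0)
        then show ?thesis using g0 by (simp add: no_blowup_in_def sx life0)
      qed
      then show ?thesis by (simp add: no_blowup_in_def True ext)
    next
      case False
      have "strict_mono (\<lambda>m::nat. m)" by (simp add: strict_mono_def)
      from adm[OF this] False show ?thesis
        unfolding strongly_semi_singular_admissible_def no_blowup_in_def life_eq_all_iff
        by (auto simp: ext)
    qed
    show "(\<forall>\<^sub>F k in sequentially. t k \<in> life (?\<phi> (n k)) (s k, x k)) \<and>
        (\<lambda>k. snd (run (?\<phi> (n k)) (s k, x k) (t k))) \<longlonglongrightarrow> run \<pi>0 x0 t0"
      if n: "index_sequence n" and t: "\<forall>k. 0 \<le> t k" and x: "x \<longlonglongrightarrow> x0" and tl: "t \<longlonglongrightarrow> t0"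
        and t0: "t0 \<in> life \<pi>0 x0" for n s x t x0 t0
      using n unfolding index_sequence_def
    proof
      assume z: "\<forall>k. n k = 0"
      have c: "(\<forall>\<^sub>F k in sequentially. t k \<in> life \<pi>0 (x k)) \<and> (\<lambda>k. run \<pi>0 (x k) (t k)) \<longlonglongrightarrow> run \<pi>0 x0 t0"
        by (rule local_semiflow_continuous[OF l0 t tl t0 x])
      have "\<forall>\<^sub>F k in sequentially. run \<pi>0 (x k) (t k) = snd (run (?\<phi> (n k)) (s k, x k) (t k))"
        using conjunct1[OF c] by eventually_elim (simp add: z ext run0)
      then have "(\<lambda>k. snd (run (?\<phi> (n k)) (s k, x k) (t k))) \<longlonglongrightarrow> run \<pi>0 x0 t0"
        by (rule Lim_transform_eventually[OF conjunct2[OF c]])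
      then show ?thesis using c by (simp add: z ext life0)
    next
      assume z: "strict_mono n \<and> (\<forall>k. 1 \<le> n k)"
      have e: "?\<phi> (n k) = \<pi>s (n k)" for k using z ext(2) by blast
      have "ereal t0 < omega \<pi>0 x0" using t0 by (simp add: life_def)
      from semi_singular_convergence_subseq[OF conv conjunct1[OF z] t tl this x, of s]
      show ?thesis using dom_iff_life[OF l] z by (simp add: e)
    qed
    show "\<exists>r l. strict_mono r \<and> (\<lambda>k. snd (run (?\<phi> (n (r k))) (z (r k)) (t (r k)))) \<longlonglongrightarrow> l"
      if n: "index_sequence n" and st: "\<forall>k. 0 \<le> t k \<and> stays (?\<phi> (n k)) (z k) (t k) (UNIV \<times> Nt)"
        and tl: "filterlim t at_top sequentially" for n z t
      using n unfolding index_sequence_def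
    proof
      assume z: "\<forall>k. n k = 0"
      have st0: "stays \<pi>0 (snd (z k)) (t k) Nt" for k
        using st[rule_format, of k] z run0 unfolding stays_def
        by (cases "z k") (auto simp: ext life0)
      have a: "t k \<in> life \<pi>0 (snd (z k))" for k using stays_life[OF st0] st by auto
      have b: "run \<pi>0 (snd (z k)) ` {0..t k} \<subseteq> Nt" for k using st0 by (auto simp: stays_def)
      have *: "(\<forall>k\<ge>1. t k \<in> life \<pi>0 (snd (z k)) \<and> run \<pi>0 (snd (z k)) ` {0..t k} \<subseteq> Nt) \<and>
          filterlim t at_top sequentially"
        using a b tl by blast
      have "\<exists>r l. strict_mono r \<and> (\<lambda>k. run \<pi>0 (snd (z (r k))) (t (r k))) \<longlonglongrightarrow> l"
        using adm0[unfolded strongly_admissible_def, THEN conjunct2, THEN conjunct1,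
            rule_format, OF *] .
      moreover have "run \<pi>0 (snd (z k)) (t k) = snd (run (?\<phi> (n k)) (z k) (t k))" for k
        using run0[OF a[of k], of "fst (z k)"] by (simp add: z ext)
      ultimately show ?thesis by auto
    next
      assume z: "strict_mono n \<and> (\<forall>k. 1 \<le> n k)"
      have e: "?\<phi> (n k) = \<pi>s (n k)" for k using z ext(2) by blast
      have a: "t k \<in> life (\<pi>s (n k)) (fst (z k), snd (z k))" for k
        using stays_life[of "\<pi>s (n k)" "z k" "t k" "UNIV \<times> Nt" "t k"] st[rule_format, of k] by (simp add: e)
      have b: "run (\<pi>s (n k)) (fst (z k), snd (z k)) ` {0..t k} \<subseteq> UNIV \<times> Nt" for k
        using st[rule_format, of k] unfolding stays_def e prod.collapse by blast
      have *: "(\<forall>k\<ge>1. t k \<in> life (\<pi>s (n k)) (fst (z k), snd (z k)) \<and>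
            run (\<pi>s (n k)) (fst (z k), snd (z k)) ` {0..t k} \<subseteq> UNIV \<times> Nt) \<and>
          filterlim t at_top sequentially"
        using a b tl by blast
      have "\<exists>r l. strict_mono r \<and>
          (\<lambda>k. snd (run (\<pi>s (n (r k))) (fst (z (r k)), snd (z (r k))) (t (r k)))) \<longlonglongrightarrow> l"
        using adm[OF conjunct1[OF z], unfolded strongly_semi_singular_admissible_def,
            THEN conjunct2, THEN conjunct1, rule_format, OF *] .
      then show ?thesis by (simp add: e)
    qed
  qed
qed

theorem theorem14:
  fixes \<pi>0 :: "'x::metric_space pflow"
    and \<pi>s :: "nat \<Rightarrow> (real \<times> 'x) pflow"
    and Nt :: "'x set"
  assumes "local_semiflow \<pi>0"
    and "\<And>n. n \<ge> 1 \<Longrightarrow> local_semiflow (\<pi>s n)"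
    and "closed Nt"
    and "strongly_admissible \<pi>0 Nt"
    and "semi_singular_convergence \<pi>s \<pi>0"
    and "\<And>r :: nat \<Rightarrow> nat. strict_mono r \<Longrightarrow>
           strongly_semi_singular_admissible (\<lambda>m. \<pi>s (r m)) (UNIV \<times> Nt)"
    and "max_inv \<pi>0 Nt \<subseteq> interior Nt"
  shows "\<exists>n0\<ge>1. \<exists>N N'. closed N \<and> closed N' \<and>
    (\<exists>Ns Ls Ns' Ls' :: nat \<Rightarrow> (real \<times> 'x) set.
       Ns' 0 = UNIV \<times> N' \<and> Ns 0 = UNIV \<times> N \<and>
       (\<forall>n \<in> {n. n \<ge> n0} \<union> {0}.
          max_inv (extended_family \<pi>0 \<pi>s n) (UNIV \<times> Nt) \<subseteq> UNIV \<times> N' \<and>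
          UNIV \<times> N' \<subseteq> interior (UNIV \<times> N) \<and>
          interior ((UNIV :: real set) \<times> N) \<subseteq> interior (UNIV \<times> Nt) \<and>
          index_pair (extended_family \<pi>0 \<pi>s n) (Ns' 0) (Ns' n) (Ls' n) \<and>
          index_pair (extended_family \<pi>0 \<pi>s n) (Ns 0) (Ns n) (Ls n) \<and>
          Ns' n \<subseteq> Ns' 0 \<and> Ns' 0 \<subseteq> Ns n \<and> Ns n \<subseteq> Ns 0 \<and>
          Ls' n \<subseteq> Ls' 0 \<and> Ls' 0 \<subseteq> Ls n \<and> Ls n \<subseteq> Ls 0))"
proof -
  interpret semi_singular_limit \<pi>0 "extended_family \<pi>0 \<pi>s" Nt
    by (rule semi_singular_limit_extended_family[OF assms(1-6)])
  have "closed core" "closed (- interior Nt)" "core \<inter> - interior Nt = {}"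
    using compact_imp_closed[OF compact_core] core_subset_max_inv assms(7) by auto
  then obtain U V where UV: "open U" "open V" "core \<subseteq> U" "- interior Nt \<subseteq> V" "U \<inter> V = {}"
    using t4_space by metis
  \<comment> \<open>Normality separates the compact core from the complement of the interior of \<open>Nt\<close>.\<close>
  interpret semi_singular_isolation \<pi>0 "extended_family \<pi>0 \<pi>s" Nt "- V"
  proof
    show "closed (- V)" using UV by (simp add: closed_Compl)
    show "core \<subseteq> interior (- V)" using UV interior_maximal[of U "- V"] by blast
    show "- V \<subseteq> interior Nt" using UV by blast
  qed
  show ?thesis by (rule nested_index_pairs)
qed

end
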